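(* Let $\varepsilon_j>0$ with $\varepsilon_j\to0$. For every $(\theta,g)\in L^1(I)\times L^2(I)$ and every sequence $(\theta_j,g_j)\in\mathcal Y_C$ such that $(\theta_j,g_j)$ converges to $(\theta,g)$ in $L^1(I)\times L^2(I)$, there holds $$\liminf_{j\to\infty}G^C_{\varepsilon_j}(\theta_j,g_j)\ \ge\ G^C_0(\theta,g),$$ and $(\theta,g)\in\mathcal A_C$.
   Context: Fix constants $\sigma>0$, $D_1>0$, $D_2>0$, $l>0$ and let $I=(-l,l)$. Let $$W(\theta)=8D_2\sin^8\tfrac\theta2+4(1+\sigma)\sin^4\tfrac\theta2-4\sigma\sin^2\tfrac\theta2+a_0,$$ where the constant $a_0$ is chosen so that $\min W=0$. On $[-\pi,\pi]$, $W$ has exactly two zeros $\pm\beta$, with $0<\beta<\pi/2$. Let $\Phi(s)=2\int_{-\beta}^s\sqrt{W(t)}\,dt$. For $\varepsilon>0$ let $$F^C_\varepsilon(\theta,g)=\int_I\Big[D_1\varepsilon(g''+\cos\theta\,\theta')^2+\frac{D_2}{2\varepsilon}(g'+\sin\theta)^4+\frac1\varepsilon(g'+\sin\theta)^2+\frac{4D_2}{\varepsilon}(g'+\sin\theta)^2\sin^4\tfrac\theta2+\varepsilon\theta'^2+\frac1\varepsilon W(\theta)\Big]dx .$$ Let $$\mathcal Y_C=\{(\theta,g)\in W^{1,2}(I)\times W^{2,2}(I):\ \theta(-l)=\theta(l),\ g(-l)=g(l),\ g'(-l)=g'(l)\},$$ $$\mathcal A_C=\Big\{(\theta,g)\in BV(I)\times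 W^{1,2}(I):\ g'\in BV(I),\ g'+\sin\theta=0\text{ a.e.},\ \int_I\theta=0\Big\}.$$ Define $G^C_\varepsilon(\theta,g)=F^C_\varepsilon(\theta,g)$ if $(\theta,g)\in\mathcal Y_C$ and $+\infty$ otherwise; and $$G^C_0(\theta,g)=\int_I|(\Phi\circ\theta)'|+|\Phi(\tilde\theta(l))-\Phi(\tilde\theta(-l))|$$ if $(\theta,g)\in\mathcal A_C$ and $+\infty$ otherwise, where $\int_I|(\Phi\circ\theta)'|$ is the total variation of $\Phi\circ\theta$ on $I$ and $\tilde\theta(\pm l)$ are the (one-sided, from inside $I$) traces of $\theta$ at $\pm l$.
   Formalization: The limit θ is assumed to take values in [-π,π] a.e. (otherwise shifting θ_j by 2π violates the mean-zero condition and the inequality fails), and (θ,g)∈A_C is claimed only when the liminf is finite (the constant sequence (π/4,0) is a counterexample otherwise). *)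

theory Defs
  imports "HOL-Analysis.Analysis"
begin

section \<open>Function spaces on an open set of reals\<close>

text \<open>Elements of the function spaces are represented by functions on all of \<open>real\<close>, of which only
  the restriction to \<open>S\<close> up to null sets is relevant.\<close>

definition L1_on :: "real set \<Rightarrow> (real \<Rightarrow> real) set" where
  "L1_on S = {u. integrable (lebesgue_on S) u}"

definition L2_on :: "real set \<Rightarrow> (real \<Rightarrow> real) set" where
  "L2_on S = {u. u \<in> borel_measurable (lebesgue_on S) \<and> integrable (lebesgue_on S) (\<lambda>x. (u x)\<^sup>2)}"

definition L1_dist :: "real set \<Rightarrow> (real \<Rightarrow> real) \<Rightarrow> (real \<Rightarrow> real) \<Rightarrow> real" where
  "L1_dist S u v = (\<integral>x. \<bar>u x - v x\<bar> \<partial>lebesgue_on S)"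

definition L2_dist :: "real set \<Rightarrow> (real \<Rightarrow> real) \<Rightarrow> (real \<Rightarrow> real) \<Rightarrow> real" where
  "L2_dist S u v = sqrt (\<integral>x. (u x - v x)\<^sup>2 \<partial>lebesgue_on S)"

definition loc_integrable_on :: "(real \<Rightarrow> real) \<Rightarrow> real set \<Rightarrow> bool" where
  "loc_integrable_on u S \<longleftrightarrow> (\<forall>K. compact K \<and> K \<subseteq> S \<longrightarrow> integrable (lebesgue_on K) u)"

definition C1c :: "real set \<Rightarrow> (real \<Rightarrow> real) set" where
  "C1c S = {\<phi>. \<phi> C1_differentiable_on UNIV \<and>
                compact (closure {x. \<phi> x \<noteq> 0}) \<and> closure {x. \<phi> x \<noteq> 0} \<subseteq> S}"

text \<open>Weak derivatives and the total variation are tested against \<open>C\<^sup>1\<close> functions with compact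
  support; by mollification, smooth test functions would give the same notions.\<close>

definition has_weak_deriv :: "real set \<Rightarrow> (real \<Rightarrow> real) \<Rightarrow> (real \<Rightarrow> real) \<Rightarrow> bool" where
  "has_weak_deriv S u v \<longleftrightarrow> loc_integrable_on u S \<and> loc_integrable_on v S \<and>
     (\<forall>\<phi>\<in>C1c S. (\<integral>x. u x * deriv \<phi> x \<partial>lebesgue_on S) = - (\<integral>x. v x * \<phi> x \<partial>lebesgue_on S))"

text \<open>Weak derivatives are unique up to null sets; the choice of a representative is immaterial
  for every use below.\<close>

definition weak_deriv :: "real set \<Rightarrow> (real \<Rightarrow> real) \<Rightarrow> real \<Rightarrow> real" where
  "weak_deriv S u = (SOME v. has_weak_deriv S u v)"

definition W12 :: "real set \<Rightarrow> (real \<Rightarrow> real) set" where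
  "W12 S = {u \<in> L2_on S. \<exists>v\<in>L2_on S. has_weak_deriv S u v}"

definition W22 :: "real set \<Rightarrow> (real \<Rightarrow> real) set" where
  "W22 S = {u \<in> W12 S. weak_deriv S u \<in> W12 S}"

text \<open>The truncation of negative numbers by \<open>ennreal\<close> does not affect the supremum, since
  \<open>\<phi> = 0\<close> is admissible.\<close>

definition total_variation :: "real set \<Rightarrow> (real \<Rightarrow> real) \<Rightarrow> ennreal" where
  "total_variation S u =
     (SUP \<phi>\<in>{\<phi> \<in> C1c S. \<forall>x. \<bar>\<phi> x\<bar> \<le> 1}. ennreal (\<integral>x. u x * deriv \<phi> x \<partial>lebesgue_on S))"

definition BV :: "real set \<Rightarrow> (real \<Rightarrow> real) set" where
  "BV S = {u \<in> L1_on S. total_variation S u < \<infinity>}"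

text \<open>One-sided traces in the sense of \<open>BV\<close> functions, at \<open>b\<close> from the left and at \<open>a\<close> from
  the right.\<close>

definition trace_left :: "(real \<Rightarrow> real) \<Rightarrow> real \<Rightarrow> real" where
  "trace_left u b = (THE c.
     ((\<lambda>r. (\<integral>x. \<bar>u x - c\<bar> \<partial>lebesgue_on {b-r<..<b}) / r) \<longlongrightarrow> 0) (at_right 0))"

definition trace_right :: "(real \<Rightarrow> real) \<Rightarrow> real \<Rightarrow> real" where
  "trace_right u a = (THE c.
     ((\<lambda>r. (\<integral>x. \<bar>u x - c\<bar> \<partial>lebesgue_on {a<..<a+r}) / r) \<longlongrightarrow> 0) (at_right 0))"

text \<open>Equality of the boundary values of the continuous representative.\<close>

definition periodic_bdry :: "real \<Rightarrow> (real \<Rightarrow> real) \<Rightarrow> bool" where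
  "periodic_bdry l u \<longleftrightarrow> (\<exists>\<rho>. continuous_on {-l..l} \<rho> \<and>
     (AE x in lebesgue_on {-l<..<l}. u x = \<rho> x) \<and> \<rho> (-l) = \<rho> l)"

section \<open>The double-well potential\<close>

definition W_raw :: "real \<Rightarrow> real \<Rightarrow> real \<Rightarrow> real" where
  "W_raw \<sigma> D2 \<theta> = 8 * D2 * sin (\<theta>/2) ^ 8 + 4 * (1 + \<sigma>) * sin (\<theta>/2) ^ 4 - 4 * \<sigma> * sin (\<theta>/2) ^ 2"

definition a0 :: "real \<Rightarrow> real \<Rightarrow> real" where
  "a0 \<sigma> D2 = - (INF \<theta>. W_raw \<sigma> D2 \<theta>)"

definition W :: "real \<Rightarrow> real \<Rightarrow> real \<Rightarrow> real" where
  "W \<sigma> D2 \<theta> = W_raw \<sigma> D2 \<theta> + a0 \<sigma> D2"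

definition well :: "real \<Rightarrow> real \<Rightarrow> real" where
  "well \<sigma> D2 = (THE \<beta>. 0 < \<beta> \<and> \<beta> < pi/2 \<and> {\<theta>\<in>{-pi..pi}. W \<sigma> D2 \<theta> = 0} = {-\<beta>, \<beta>})"

lemma W_wells:
  assumes s: "\<sigma> > 0" and D: "D2 > 0"
  shows "W \<sigma> D2 \<theta> \<ge> 0"
    and "0 < well \<sigma> D2 \<and> well \<sigma> D2 < pi/2 \<and>
         {\<theta>\<in>{-pi..pi}. W \<sigma> D2 \<theta> = 0} = {-well \<sigma> D2, well \<sigma> D2}"
proof -
  define d :: "real \<Rightarrow> real" where "d = (\<lambda>t. 32 * D2 * t^3 + 8 * (1 + \<sigma>) * t - 4 * \<sigma>)"
  define p :: "real \<Rightarrow> real" where "p = (\<lambda>t. 8 * D2 * t^4 + 4 * (1 + \<sigma>) * t^2 - 4 * \<sigma> * t)"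
  have "\<exists>t\<ge>0. t \<le> 1/2 \<and> d t = 0"
    by (rule IVT') (use s D in \<open>auto simp: d_def field_simps intro!: continuous_intros\<close>)
  then obtain t0 where t0: "0 \<le> t0" "t0 \<le> 1/2" "d t0 = 0" by auto
  have "d 0 \<noteq> 0" using s by (simp add: d_def)
  then have t0_pos: "0 < t0" using t0 by (cases "t0 = 0") auto
  have "d (1/2) \<noteq> 0" using s D by (simp add: d_def power3_eq_cube add_divide_distrib)
  then have t0_less: "t0 < 1/2" using t0 by (cases "t0 = 1/2") auto
  define q where "q = (\<lambda>t. 4 * (1 + \<sigma>) + 8 * D2 * (t^2 + 2 * t * t0 + 3 * t0^2))"
  have p_eq: "p t = p t0 + (t - t0)^2 * q t" for t
  proof -
    have "p t - p t0 - (t - t0)^2 * q t = d t0 * (t - t0)"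
      unfolding p_def q_def d_def by algebra
    then show ?thesis using t0 by simp
  qed
  have q_pos: "q t > 0" if "t \<ge> 0" for t
    unfolding q_def using s D t0 that by (intro add_pos_nonneg mult_nonneg_nonneg) auto
  have raw: "W_raw \<sigma> D2 \<theta> = p ((sin (\<theta>/2))\<^sup>2)" for \<theta>
    by (simp add: W_raw_def p_def flip: power_mult)
  define b where "b = 2 * arcsin (sqrt t0)"
  have sq: "0 < sqrt t0" "sqrt t0 < sqrt (1/2)" "sqrt (1/2) < (1::real)" "sqrt t0 < 1"
    using t0_pos t0_less by auto
  have sq': "-1 \<le> sqrt t0" "sqrt t0 \<le> 1" using sq(1,4) by linarith+
  have sin_b: "sin (b/2) = sqrt t0"
    unfolding b_def using sin_arcsin[OF sq'] by simp
  have b_pos: "0 < b" unfolding b_def using sq arcsin_less_mono[of 0 "sqrt t0"] by (simp add: abs_if)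
  have "arcsin (sqrt t0) < arcsin (sqrt (1/2))"
    using sq by (subst arcsin_less_mono) auto
  also have "arcsin (sqrt (1/2)) = pi/4"
  proof -
    have "sqrt (1/2) = sin (pi/4)"
      by (simp add: sin_45 real_sqrt_divide field_simps)
    moreover have "arcsin (sin (pi/4)) = pi/4" by (rule arcsin_sin) auto
    ultimately show ?thesis by simp
  qed
  finally have b_less: "b < pi/2" by (simp add: b_def)
  have raw_b: "W_raw \<sigma> D2 b = p t0" using t0_pos by (simp add: raw sin_b)
  have raw_ge: "p t0 \<le> W_raw \<sigma> D2 \<theta>" for \<theta>
    unfolding raw using p_eq[of "(sin (\<theta>/2))\<^sup>2"] q_pos[of "(sin (\<theta>/2))\<^sup>2"]
    by simp
  have "(INF \<theta>. W_raw \<sigma> D2 \<theta>) = p t0"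
    by (rule cInf_eq_minimum) (use raw_ge rangeI[of "W_raw \<sigma> D2" b] in \<open>auto simp only: raw_b\<close>)
  then have a0: "a0 \<sigma> D2 = - p t0" by (simp add: a0_def)
  show "W \<sigma> D2 \<theta> \<ge> 0" unfolding W_def a0 using raw_ge by simp
  have W_0_iff: "W \<sigma> D2 \<theta> = 0 \<longleftrightarrow> (sin (\<theta>/2))\<^sup>2 = t0" for \<theta>
    unfolding W_def a0 raw using p_eq[of "(sin (\<theta>/2))\<^sup>2"] q_pos[of "(sin (\<theta>/2))\<^sup>2"]
    by auto
  have zeros: "{\<theta>\<in>{-pi..pi}. W \<sigma> D2 \<theta> = 0} = {-b, b}"
  proof (intro set_eqI iffI)
    fix \<theta> assume "\<theta> \<in> {\<theta>\<in>{-pi..pi}. W \<sigma> D2 \<theta> = 0}"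
    then have th: "-pi \<le> \<theta>" "\<theta> \<le> pi" "(sin (\<theta>/2))\<^sup>2 = t0" using W_0_iff by auto
    have "sin (\<theta>/2) = sqrt t0 \<or> sin (\<theta>/2) = - sqrt t0"
      using th(3) t0 by (metis power2_eq_iff real_sqrt_pow2)
    then have "sin (\<theta>/2) = sin (b/2) \<or> sin (\<theta>/2) = sin (-(b/2))"
      using sin_b by simp
    then have "\<theta>/2 = b/2 \<or> \<theta>/2 = -(b/2)"
      using th b_pos b_less sin_inj_pi[of "\<theta>/2" "b/2"] sin_inj_pi[of "\<theta>/2" "-(b/2)"] by auto
    then have "\<theta> = b \<or> \<theta> = -b" by linarith
    then show "\<theta> \<in> {-b, b}" by blast
  next
    fix \<theta> assume "\<theta> \<in> {-b, b}"
    then have "\<theta> = b \<or> \<theta> = -b" by blast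
    then have "(sin (\<theta>/2))\<^sup>2 = t0" "-pi \<le> \<theta>" "\<theta> \<le> pi"
      using b_pos b_less sin_b t0(1) by (auto simp: sin_minus)
    then show "\<theta> \<in> {\<theta>\<in>{-pi..pi}. W \<sigma> D2 \<theta> = 0}"
      using W_0_iff by simp
  qed
  have "\<exists>!\<beta>. 0 < \<beta> \<and> \<beta> < pi/2 \<and> {\<theta>\<in>{-pi..pi}. W \<sigma> D2 \<theta> = 0} = {-\<beta>, \<beta>}"
  proof (rule ex1I[of _ b])
    show "0 < b \<and> b < pi/2 \<and> {\<theta>\<in>{-pi..pi}. W \<sigma> D2 \<theta> = 0} = {-b, b}"
      using b_pos b_less zeros by blast
    fix \<beta> assume "0 < \<beta> \<and> \<beta> < pi/2 \<and> {\<theta>\<in>{-pi..pi}. W \<sigma> D2 \<theta> = 0} = {-\<beta>, \<beta>}"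
    then have "0 < \<beta>" "{-\<beta>, \<beta>} = {-b, b}" using zeros by (blast, metis)
    then show "\<beta> = b" using b_pos by (metis doubleton_eq_iff less_asym neg_less_0_iff_less)
  qed
  from theI'[OF this] show "0 < well \<sigma> D2 \<and> well \<sigma> D2 < pi/2 \<and>
      {\<theta>\<in>{-pi..pi}. W \<sigma> D2 \<theta> = 0} = {-well \<sigma> D2, well \<sigma> D2}"
    unfolding well_def .
qed

definition Phi :: "real \<Rightarrow> real \<Rightarrow> real \<Rightarrow> real" where
  "Phi \<sigma> D2 s = 2 * (LBINT t=ereal (- well \<sigma> D2)..ereal s. sqrt (W \<sigma> D2 t))"

section \<open>The energies\<close>

text \<open>For \<open>\<epsilon> > 0\<close> the integrand is nonnegative, so the energy is an integral with values in
  \<open>[0, \<infinity>]\<close>.\<close>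

definition F_C :: "real \<Rightarrow> real \<Rightarrow> real \<Rightarrow> real \<Rightarrow> real \<Rightarrow> (real \<Rightarrow> real) \<Rightarrow> (real \<Rightarrow> real) \<Rightarrow> ennreal" where
  "F_C \<sigma> D1 D2 l \<epsilon> \<theta> g =
    (let I = {-l<..<l}; \<theta>' = weak_deriv I \<theta>; g' = weak_deriv I g; g'' = weak_deriv I g' in
     \<integral>\<^sup>+x. ennreal (
        D1 * \<epsilon> * (g'' x + cos (\<theta> x) * \<theta>' x)^2
      + D2 / (2 * \<epsilon>) * (g' x + sin (\<theta> x))^4
      + 1 / \<epsilon> * (g' x + sin (\<theta> x))^2
      + 4 * D2 / \<epsilon> * (g' x + sin (\<theta> x))^2 * sin (\<theta> x / 2)^4
      + \<epsilon> * (\<theta>' x)^2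
      + 1 / \<epsilon> * W \<sigma> D2 (\<theta> x)) \<partial>lebesgue_on I)"

definition Y_C :: "real \<Rightarrow> ((real \<Rightarrow> real) \<times> (real \<Rightarrow> real)) set" where
  "Y_C l = {(\<theta>, g). \<theta> \<in> W12 {-l<..<l} \<and> g \<in> W22 {-l<..<l} \<and>
     periodic_bdry l \<theta> \<and> periodic_bdry l g \<and> periodic_bdry l (weak_deriv {-l<..<l} g)}"

definition A_C :: "real \<Rightarrow> ((real \<Rightarrow> real) \<times> (real \<Rightarrow> real)) set" where
  "A_C l = {(\<theta>, g). \<theta> \<in> BV {-l<..<l} \<and> g \<in> W12 {-l<..<l} \<and> weak_deriv {-l<..<l} g \<in> BV {-l<..<l} \<and>
     (AE x in lebesgue_on {-l<..<l}. weak_deriv {-l<..<l} g x + sin (\<theta> x) = 0) \<and>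
     (\<integral>x. \<theta> x \<partial>lebesgue_on {-l<..<l}) = 0}"

definition G_C :: "real \<Rightarrow> real \<Rightarrow> real \<Rightarrow> real \<Rightarrow> real \<Rightarrow> (real \<Rightarrow> real) \<Rightarrow> (real \<Rightarrow> real) \<Rightarrow> ennreal" where
  "G_C \<sigma> D1 D2 l \<epsilon> \<theta> g = (if (\<theta>, g) \<in> Y_C l then F_C \<sigma> D1 D2 l \<epsilon> \<theta> g else \<infinity>)"

definition G0_C :: "real \<Rightarrow> real \<Rightarrow> real \<Rightarrow> (real \<Rightarrow> real) \<Rightarrow> (real \<Rightarrow> real) \<Rightarrow> ennreal" where
  "G0_C \<sigma> D2 l \<theta> g =
    (if (\<theta>, g) \<in> A_C l
     then total_variation {-l<..<l} (Phi \<sigma> D2 \<circ> \<theta>) +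
          ennreal \<bar>Phi \<sigma> D2 (trace_left \<theta> l) - Phi \<sigma> D2 (trace_right \<theta> (-l))\<bar>
     else \<infinity>)"

end

theory Submission
  imports Defs
begin

text \<open>By Young's inequality the energy dominates \<open>\<integral>\<bar>(\<Phi> \<circ> \<theta>\<^sub>j)'\<bar>\<close>, and \<open>\<Phi> \<circ> \<theta>\<^sub>j\<close> is periodic, so
  integrating by parts against a \<open>C\<^sup>1\<close> function \<open>\<phi>\<close> with \<open>\<bar>\<phi>\<bar> \<le> 1\<close> and \<open>\<phi>(-l) = \<phi>(l)\<close> produces no boundary
  term: \<open>\<integral>(\<Phi> \<circ> \<theta>) \<phi>' \<le> liminf F\<close> in the limit, also for test functions that do not vanish at \<open>\<plusminus>l\<close>.
  The limit \<open>\<theta>\<close> takes only the values \<open>\<plusminus>\<beta>\<close> and is constant near the end points, and choosing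
  \<open>\<phi> = \<plusminus>1\<close> there yields the jump term in addition to the total variation. Finally,
  \<open>g\<^sub>j' + sin \<theta>\<^sub>j \<rightarrow> 0\<close> in \<open>L\<^sup>2\<close> gives \<open>g' = - sin \<theta>\<close>, the periodicity of \<open>g\<^sub>j\<close> gives \<open>\<integral>sin \<theta> = 0\<close>, and
  on \<open>{-\<beta>, \<beta>}\<close> both \<open>\<theta>\<close> and \<open>sin \<theta>\<close> are affine functions of \<open>\<Phi>(\<theta>)\<close>.\<close>

section \<open>Absolutely continuous functions\<close>

text \<open>The limit functional is the variation of \<open>\<Phi> \<circ> \<theta>\<close> on the
  circle obtained by gluing -l to l. \<open>total_variation\<close> only admits test functions
  supported inside the open interval, so it is blind to the glued point; recovering that part shapes
  the proof. Constancy near the ends comes from counting: each passage between the wells costs the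
  fixed amount \<open>\<Phi> \<beta>\<close> > 0, while one bound M controls the variation of all
  \<open>\<Phi> \<circ> \<theta>\<^sub>j\<close>, so the passages cannot accumulate at an end point.
  Traces of the limit are then values of a constant. The weights \<epsilon> and 1/\<epsilon> cancel
  in Young's inequality \<epsilon> v^2 + w/\<epsilon> \<ge> 2 sqrt(w) |v|, which is where the factor
  2 in \<open>Phi\<close> originates. \<open>W\<close> is a bounded trigonometric polynomial, so
  \<open>Phi\<close> is globally Lipschitz and L1 convergence passes from
  \<open>\<theta>\<^sub>j\<close> to \<open>\<Phi> \<circ> \<theta>\<^sub>j\<close> without
  truncation. The liminf is treated last: everything is proved for energies bounded by a real M and
  then applied, for each M above the liminf, to a suitable subsequence.\<close>

lemma integrable_lebesgue_on_Icc_iff: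
  fixes f :: "real \<Rightarrow> real"
  shows "integrable (lebesgue_on {a..b}) f \<longleftrightarrow> f absolutely_integrable_on {a..b}"
  by (simp add: set_integrable_def integrable_restrict_space)

lemma integrable_lebesgue_on_Ioo_iff:
  fixes f :: "real \<Rightarrow> real"
  shows "integrable (lebesgue_on {a<..<b}) f \<longleftrightarrow> f absolutely_integrable_on {a..b}"
  unfolding absolutely_integrable_on_Icc_iff_Ioo
  by (simp add: set_integrable_def integrable_restrict_space)

lemma integral_lebesgue_on_Ioo:
  fixes f :: "real \<Rightarrow> real"
  assumes "f absolutely_integrable_on {a..b}"
  shows "(\<integral>x. f x \<partial>lebesgue_on {a<..<b}) = integral {a..b} f"
  using assms lebesgue_integral_eq_integral[of "{a<..<b}" f]
  by (simp add: integrable_lebesgue_on_Ioo_iff integral_open_interval_real)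

text \<open>After passing to a Borel function g equal almost everywhere to the extension of d by
  zero, the positive and negative parts of g have the same integral over every half line. As
  densities they define the same measure, so they agree almost everywhere, and parts that agree are
  both zero.\<close>

lemma AE_zero_if_interval_integrals_zero:
  fixes d :: "real \<Rightarrow> real"
  assumes d: "d absolutely_integrable_on {a..b}"
    and zero: "\<And>c e. a \<le> c \<Longrightarrow> c \<le> e \<Longrightarrow> e \<le> b \<Longrightarrow> integral {c..e} d = 0"
  shows "AE x in lebesgue_on {a..b}. d x = 0"
proof -
  define f where "f = (\<lambda>x. indicator {a..b} x * d x)"
  have f: "integrable lebesgue f"
    using d by (simp add: f_def set_integrable_def)
  obtain g where g [measurable]: "g \<in> borel_measurable lborel" and fg: "AE x in lborel. f x = g x"
    using completion_ex_borel_measurable_real[OF borel_measurable_integrable[OF f]] by auto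
  have fg': "AE x in lebesgue. f x = g x" by (rule AE_completion[OF fg])
  have gL: "integrable lebesgue g"
    using f fg' by (subst integrable_cong_AE[of _ _ f]) (auto intro: measurable_completion simp: eq_commute)
  then have g_int: "integrable lborel g"
    by (simp add: integrable_completion)
  have half: "(\<integral>x. indicator {c<..} x * g x \<partial>lborel) = 0" for c
  proof -
    have "(\<integral>x. indicator {c<..} x * g x \<partial>lborel) = (\<integral>x. indicator {c<..} x * g x \<partial>lebesgue)"
      by (simp add: integral_completion)
    also have "\<dots> = (\<integral>x. indicator {c<..} x * f x \<partial>lebesgue)"
      using fg' f gL
      by (intro integral_cong_AE borel_measurable_times borel_measurable_indicator borel_measurable_integrable) auto
    also have "\<dots> = (\<integral>x. indicator ({c<..} \<inter> {a..b}) x * d x \<partial>lebesgue)"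
      by (simp add: f_def indicator_inter_arith mult.assoc)
    also have "\<dots> = integral ({c<..} \<inter> {a..b}) d"
    proof -
      have "d absolutely_integrable_on ({c<..} \<inter> {a..b})"
        using d by (rule set_integrable_subset) auto
      from set_lebesgue_integral_eq_integral(2)[OF this] show ?thesis
        by (simp add: set_lebesgue_integral_def)
    qed
    also have "\<dots> = integral {max a c..b} d"
      by (rule integral_subset_negligible)
         (auto intro: negligible_subset[of "{c,a}"])
    also have "\<dots> = 0"
      by (cases "max a c \<le> b") (auto intro: zero)
    finally show ?thesis .
  qed
  \<comment> \<open>\<open>ennreal\<close> truncates at 0, so the two integrands are the positive
    and the negative part of g. The finiteness claim is what the comparison of measures on half
    lines asks for.\<close>
  have hp: "(\<integral>\<^sup>+x. ennreal (g x) * indicator {c<..} x \<partial>lborel) = (\<integral>\<^sup>+x. ennreal (- g x) * indicator {c<..} x \<partial>lborel)"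
       "(\<integral>\<^sup>+x. ennreal (g x) * indicator {c<..} x \<partial>lborel) < \<infinity>"for c
  proof -
    let ?p = "\<lambda>x. indicator {c<..} x * max 0 (g x)" and ?m = "\<lambda>x. indicator {c<..} x * max 0 (- g x)"
    have i: "integrable lborel (\<lambda>x. max 0 (g x))" "integrable lborel (\<lambda>x. max 0 (- g x))" using g_int by auto
    have ip: "integrable lborel ?p" "integrable lborel ?m"
      using i(1)[THEN integrable_real_mult_indicator[rotated], of "{c<..}"] i(2)[THEN integrable_real_mult_indicator[rotated], of "{c<..}"]
      by (auto simp: mult.commute)
    have "(\<integral>x. ?p x \<partial>lborel) - (\<integral>x. ?m x \<partial>lborel) = (\<integral>x. indicator {c<..} x * g x \<partial>lborel)"
      by (subst Bochner_Integration.integral_diff[symmetric, OF ip]) (auto intro!: Bochner_Integration.integral_cong simp: max_def)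
    then have eq: "(\<integral>x. ?p x \<partial>lborel) = (\<integral>x. ?m x \<partial>lborel)" using half[of c] by simp
    have P: "(\<integral>\<^sup>+x. ennreal (g x) * indicator {c<..} x \<partial>lborel) = ennreal (\<integral>x. ?p x \<partial>lborel)"
      by (subst nn_integral_eq_integral[symmetric, OF ip(1)]) (auto intro!: nn_integral_cong simp: indicator_def ennreal_max_0)
    have N: "(\<integral>\<^sup>+x. ennreal (- g x) * indicator {c<..} x \<partial>lborel) = ennreal (\<integral>x. ?m x \<partial>lborel)"
      by (subst nn_integral_eq_integral[symmetric, OF ip(2)]) (auto intro!: nn_integral_cong simp: indicator_def ennreal_max_0)
    show "(\<integral>\<^sup>+x. ennreal (g x) * indicator {c<..} x \<partial>lborel) = (\<integral>\<^sup>+x. ennreal (- g x) * indicator {c<..} x \<partial>lborel)"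
       "(\<integral>\<^sup>+x. ennreal (g x) * indicator {c<..} x \<partial>lborel) < \<infinity>"
      by (simp_all add: P N eq)
  qed
  have "density lborel (\<lambda>x. ennreal (g x)) = density lborel (\<lambda>x. ennreal (- g x))"
    by (rule measure_eqI_lessThan) (use hp in \<open>simp_all add: emeasure_density\<close>)
  moreover have "(\<integral>\<^sup>+x. ennreal (g x) \<partial>lborel) \<noteq> \<infinity>"
    using g_int by (metis infinity_ennreal_def real_integrable_def)
  ultimately have "AE x in lborel. ennreal (g x) = ennreal (- g x)"
    by (subst (asm) finite_density_unique) auto
  \<comment> \<open>At most one of \<open>ennreal (g x)\<close> and \<open>ennreal (- g x)\<close>
    is nonzero, so their equality forces both to vanish.\<close>
  then have "AE x in lborel. g x = 0"
    by eventually_elim (metis ennreal_eq_0_iff ennreal_inj linorder_le_cases neg_0_le_iff_le neg_equal_zero neg_le_0_iff_le order_antisym)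
  then have "AE x in lebesgue. g x = 0" by (rule AE_completion)
  with fg' have "AE x in lebesgue. f x = 0" by eventually_elim simp
  then show ?thesis
    by (simp add: AE_restrict_space_iff f_def indicator_def) (auto elim: eventually_mono)
qed

section \<open>Chain rule and integration by parts for absolutely continuous functions\<close>

text \<open>An error bound of the form \<delta> times the integral of k adds up over adjacent
  intervals. Bolzano bisection therefore extends it from short intervals around each point to the
  whole of \<open>{a..b}\<close>, and \<delta> then tends to 0.\<close>

lemma increment_eq_integral_if_local:
  fixes F h k :: "real \<Rightarrow> real"
  assumes ab: "a \<le> b" and h: "h integrable_on {a..b}" and k: "k integrable_on {a..b}"
    and loc: "\<And>\<delta> x. \<delta> > 0 \<Longrightarrow> a \<le> x \<Longrightarrow> x \<le> b \<Longrightarrow> \<exists>d>0. \<forall>c e. a \<le> c \<and> c \<le> x \<and> x \<le> e \<and> e \<le> b \<and> e - c < d \<longrightarrow>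
       \<bar>F e - F c - integral {c..e} h\<bar> \<le> \<delta> * integral {c..e} k"
  shows "F b - F a = integral {a..b} h"
proof -
  have main: "\<bar>F b - F a - integral {a..b} h\<bar> \<le> \<delta> * integral {a..b} k" if \<delta>: "\<delta> > 0" for \<delta>
  proof -
    define P where "P = (\<lambda>c e. a \<le> c \<and> c \<le> e \<and> e \<le> b \<longrightarrow> \<bar>F e - F c - integral {c..e} h\<bar> \<le> \<delta> * integral {c..e} k)"
    have "P a b"
      using ab
    proof (induction rule: Bolzano)
      case (trans x y z)
      show ?case unfolding P_def
      proof clarify
        assume xz: "a \<le> x" "x \<le> z" "z \<le> b"
        have "integral {x..z} f = integral {x..y} f + integral {y..z} f" if "f integrable_on {a..b}" for f :: "real \<Rightarrow> real"
          using Henstock_Kurzweil_Integration.integral_combine[of x y z f] trans xz integrable_on_subinterval[OF that, of x z]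
          by auto
        note this[OF h] this[OF k]
        moreover have "\<bar>F y - F x - integral {x..y} h\<bar> \<le> \<delta> * integral {x..y} k" "\<bar>F z - F y - integral {y..z} h\<bar> \<le> \<delta> * integral {y..z} k"
          using trans xz unfolding P_def by auto
        ultimately show "\<bar>F z - F x - integral {x..z} h\<bar> \<le> \<delta> * integral {x..z} k"
          by (simp add: distrib_left)
      qed
    next
      case (local x)
      from loc[OF \<delta> this] obtain d where "d > 0" and d: "\<And>c e. a \<le> c \<and> c \<le> x \<and> x \<le> e \<and> e \<le> b \<and> e - c < d \<Longrightarrow>
       \<bar>F e - F c - integral {c..e} h\<bar> \<le> \<delta> * integral {c..e} k" by blast
      then show ?case unfolding P_def by auto
    qed
    with ab show ?thesis by (simp add: P_def)
  qed
  have "((\<lambda>\<delta>. \<delta> * integral {a..b} k) \<longlongrightarrow> 0 * integral {a..b} k) (at_right 0)"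
    by (intro tendsto_intros)
  moreover have "\<forall>\<^sub>F \<delta> in at_right 0. \<bar>F b - F a - integral {a..b} h\<bar> \<le> \<delta> * integral {a..b} k"
    using main by (auto simp: eventually_at_right_field intro: exI[of _ 1])
  ultimately have "\<bar>F b - F a - integral {a..b} h\<bar> \<le> 0 * integral {a..b} k"
    by (intro tendsto_lowerbound[where F = "at_right 0"]) auto
  then show ?thesis by simp
qed

lemma absolutely_integrable_continuous_mult:
  fixes f g :: "real \<Rightarrow> real"
  assumes "continuous_on {a..b} f" "g absolutely_integrable_on {a..b}"
  shows "(\<lambda>x. f x * g x) absolutely_integrable_on {a..b}"
proof (rule absolutely_integrable_bounded_measurable_product_real)
  show "f \<in> borel_measurable (lebesgue_on {a..b})"
    by (rule continuous_imp_measurable_on_sets_lebesgue[OF assms(1)]) auto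
  show "bounded (f ` {a..b})"
    using assms(1) by (simp add: compact_continuous_image compact_imp_bounded)
qed (use assms in auto)

text \<open>On a short interval the mean value theorem writes the increment of \<Psi> along \<rho>
  as \<open>\<psi> (\<rho> \<xi>)\<close> times the integral of v. Replacing \<xi> by t under the
  integral costs at most \<delta> times the integral of |v|, by uniform continuity of \<psi> along
  \<rho>.\<close>

lemma absolutely_continuous_chain:
  fixes \<rho> v \<Psi> \<psi> :: "real \<Rightarrow> real"
  assumes ab: "a \<le> b" and v: "v absolutely_integrable_on {a..b}"
    and \<rho>: "\<And>x y. a \<le> x \<Longrightarrow> x \<le> y \<Longrightarrow> y \<le> b \<Longrightarrow> integral {x..y} v = \<rho> y - \<rho> x"
    and c\<rho>: "continuous_on {a..b} \<rho>"
    and \<Psi>: "\<And>s. (\<Psi> has_real_derivative \<psi> s) (at s)" and c\<psi>: "continuous_on UNIV \<psi>"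
  shows "integral {a..b} (\<lambda>t. \<psi> (\<rho> t) * v t) = \<Psi> (\<rho> b) - \<Psi> (\<rho> a)"
proof -
  have c: "continuous_on {a..b} (\<lambda>t. \<psi> (\<rho> t))"
    by (rule continuous_on_compose2[OF c\<psi> c\<rho>]) auto
  have av: "(\<lambda>t. \<bar>v t\<bar>) absolutely_integrable_on {a..b}"
    using absolutely_integrable_abs[OF v] by simp
  have h: "(\<lambda>t. \<psi> (\<rho> t) * v t) absolutely_integrable_on {a..b}"
    by (rule absolutely_integrable_continuous_mult[OF c v])
  have "\<Psi> (\<rho> b) - \<Psi> (\<rho> a) = integral {a..b} (\<lambda>t. \<psi> (\<rho> t) * v t)"
  proof (rule increment_eq_integral_if_local[OF ab])
    show "(\<lambda>t. \<psi> (\<rho> t) * v t) integrable_on {a..b}" "(\<lambda>t. \<bar>v t\<bar>) integrable_on {a..b}"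
      using h av by (auto simp: absolutely_integrable_on_def)
    fix \<delta> x :: real assume \<delta>: "\<delta> > 0" and x: "a \<le> x" "x \<le> b"
    have "uniformly_continuous_on {a..b} (\<lambda>t. \<psi> (\<rho> t))"
      by (rule compact_uniformly_continuous[OF c]) auto
    then obtain d where "d > 0" and d: "\<And>s t. s \<in> {a..b} \<Longrightarrow> t \<in> {a..b} \<Longrightarrow> dist t s < d \<Longrightarrow> dist (\<psi> (\<rho> t)) (\<psi> (\<rho> s)) < \<delta>"
      using \<delta> unfolding uniformly_continuous_on_def by metis
    show "\<exists>d>0. \<forall>c e. a \<le> c \<and> c \<le> x \<and> x \<le> e \<and> e \<le> b \<and> e - c < d \<longrightarrow>
       \<bar>\<Psi> (\<rho> e) - \<Psi> (\<rho> c) - integral {c..e} (\<lambda>t. \<psi> (\<rho> t) * v t)\<bar> \<le> \<delta> * integral {c..e} (\<lambda>t. \<bar>v t\<bar>)"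
    proof (intro exI[of _ d] conjI allI impI)
      fix c e assume ce: "a \<le> c \<and> c \<le> x \<and> x \<le> e \<and> e \<le> b \<and> e - c < d"
      have sub: "{c..e} \<subseteq> {a..b}" using ce by auto
      \<comment> \<open>The mean value theorem only gives a value z between \<open>\<rho> c\<close>
        and \<open>\<rho> e\<close>. Continuity of \<rho> pulls it back to a point of
        \<open>{c..e}\<close>, where uniform continuity can be used.\<close>
      obtain \<xi> where \<xi>: "\<xi> \<in> {c..e}" "\<Psi> (\<rho> e) - \<Psi> (\<rho> c) = \<psi> (\<rho> \<xi>) * (\<rho> e - \<rho> c)"
      proof -
        define m M where "m = min (\<rho> c) (\<rho> e)" and "M = max (\<rho> c) (\<rho> e)"
        have "\<exists>z. m \<le> z \<and> z \<le> M \<and> \<Psi> (\<rho> e) - \<Psi> (\<rho> c) = \<psi> z * (\<rho> e - \<rho> c)"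
        proof (cases "\<rho> c" "\<rho> e" rule: linorder_cases)
          case less
          from MVT2[OF less \<Psi>] show ?thesis using less by (auto simp: m_def M_def mult.commute intro!: less_imp_le)
        next
          case greater
          from MVT2[OF greater \<Psi>] obtain z where "z > \<rho> e" "z < \<rho> c" "\<Psi> (\<rho> c) - \<Psi> (\<rho> e) = (\<rho> c - \<rho> e) * \<psi> z" by blast
          then show ?thesis using greater by (intro exI[of _ z]) (auto simp: m_def M_def algebra_simps)
        qed (auto simp: m_def M_def)
        then obtain z where z: "m \<le> z" "z \<le> M" "\<Psi> (\<rho> e) - \<Psi> (\<rho> c) = \<psi> z * (\<rho> e - \<rho> c)" by blast
        have cont: "continuous_on {c..e} \<rho>" by (rule continuous_on_subset[OF c\<rho> sub])
        have "\<exists>\<xi>. c \<le> \<xi> \<and> \<xi> \<le> e \<and> \<rho> \<xi> = z"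
        proof (cases "\<rho> c \<le> \<rho> e")
          case True
          then show ?thesis using IVT'[of \<rho> c z e] z ce cont by (auto simp: m_def M_def)
        next
          case False
          then show ?thesis using IVT2'[of \<rho> e z c] z ce cont by (auto simp: m_def M_def)
        qed
        then show thesis using z that by auto
      qed
      have hv: "v absolutely_integrable_on {c..e}" and hh: "(\<lambda>t. \<psi> (\<rho> t) * v t) absolutely_integrable_on {c..e}"
        and ha: "(\<lambda>t. \<bar>v t\<bar>) absolutely_integrable_on {c..e}"
        using absolutely_integrable_on_subinterval[OF _ sub] v h av by auto
      note int = this[THEN conjunct1[OF absolutely_integrable_on_def[THEN iffD1]]]
      have "\<Psi> (\<rho> e) - \<Psi> (\<rho> c) - integral {c..e} (\<lambda>t. \<psi> (\<rho> t) * v t)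
          = integral {c..e} (\<lambda>t. \<psi> (\<rho> \<xi>) * v t - \<psi> (\<rho> t) * v t)"
        using \<xi>(2) \<rho>[of c e] ce int
        by (subst Henstock_Kurzweil_Integration.integral_diff) (auto intro: integrable_on_mult_right)
      also have "\<bar>\<dots>\<bar> \<le> integral {c..e} (\<lambda>t. \<delta> * \<bar>v t\<bar>)"
      proof (subst real_norm_def[symmetric], rule integral_norm_bound_integral)
        fix t assume t: "t \<in> {c..e}"
        have "dist (\<psi> (\<rho> \<xi>)) (\<psi> (\<rho> t)) < \<delta>"
          using t \<xi>(1) sub ce by (intro d) (auto simp: dist_real_def)
        then have "\<bar>\<psi> (\<rho> \<xi>) - \<psi> (\<rho> t)\<bar> * \<bar>v t\<bar> \<le> \<delta> * \<bar>v t\<bar>"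
          by (intro mult_right_mono) (auto simp: dist_real_def)
        then show "norm (\<psi> (\<rho> \<xi>) * v t - \<psi> (\<rho> t) * v t) \<le> \<delta> * \<bar>v t\<bar>"
          by (simp add: abs_mult flip: left_diff_distrib)
      qed (use int in \<open>auto intro!: integrable_diff integrable_on_mult_right\<close>)
      finally show "\<bar>\<Psi> (\<rho> e) - \<Psi> (\<rho> c) - integral {c..e} (\<lambda>t. \<psi> (\<rho> t) * v t)\<bar> \<le> \<delta> * integral {c..e} (\<lambda>t. \<bar>v t\<bar>)"
        by simp
    qed (use \<open>d > 0\<close> in auto)
  qed
  then show ?thesis by simp
qed

text \<open>Polarization: the product rule follows from the chain rule for \<open>(\<rho> \<plusminus> \<phi>)\<^sup>2\<close>.\<close>

lemma absolutely_continuous_by_parts: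
  fixes \<rho> v \<phi> \<phi>' :: "real \<Rightarrow> real"
  assumes ab: "a \<le> b" and v: "v absolutely_integrable_on {a..b}"
    and \<rho>: "\<And>x y. a \<le> x \<Longrightarrow> x \<le> y \<Longrightarrow> y \<le> b \<Longrightarrow> integral {x..y} v = \<rho> y - \<rho> x"
    and c\<rho>: "continuous_on {a..b} \<rho>"
    and \<phi>: "\<And>s. (\<phi> has_real_derivative \<phi>' s) (at s)" and c\<phi>': "continuous_on UNIV \<phi>'"
  shows "integral {a..b} (\<lambda>t. \<rho> t * \<phi>' t) = \<rho> b * \<phi> b - \<rho> a * \<phi> a - integral {a..b} (\<lambda>t. v t * \<phi> t)"
proof -
  have c\<phi>: "continuous_on {a..b} \<phi>"
    using \<phi> by (meson DERIV_continuous_on DERIV_subset top_greatest)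
  have c\<phi>'': "continuous_on {x..y} \<phi>'" for x y
    using c\<phi>' continuous_on_subset by blast
  have i\<phi>: "(\<phi>' has_integral \<phi> y - \<phi> x) {x..y}" if "x \<le> y" for x y
    using that \<phi> by (intro fundamental_theorem_of_calculus)
      (auto simp: has_real_derivative_iff_has_vector_derivative[symmetric] intro: DERIV_subset)
  have a\<phi>: "\<phi>' absolutely_integrable_on {a..b}"
    by (rule absolutely_integrable_continuous_real[OF c\<phi>''])
  have iv: "v integrable_on {x..y}" if "a \<le> x" "y \<le> b" for x y
    using integrable_on_subinterval[of v "{a..b}"] v that by (auto simp: absolutely_integrable_on_def)
  have key: "integral {a..b} (\<lambda>t. 2 * (\<rho> t + k * \<phi> t) * (v t + k * \<phi>' t)) = (\<rho> b + k * \<phi> b)\<^sup>2 - (\<rho> a + k * \<phi> a)\<^sup>2" for k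
  proof (rule absolutely_continuous_chain[OF ab])
    show "(\<lambda>t. v t + k * \<phi>' t) absolutely_integrable_on {a..b}"
      using v a\<phi> by (intro set_integral_add set_integrable_mult_right) auto
    show "integral {x..y} (\<lambda>t. v t + k * \<phi>' t) = \<rho> y + k * \<phi> y - (\<rho> x + k * \<phi> x)" if "a \<le> x" "x \<le> y" "y \<le> b" for x y
      using that i\<phi>[of x y] iv[of x y] \<rho>[of x y]
      by (subst Henstock_Kurzweil_Integration.integral_add)
        (auto simp: integral_unique algebra_simps has_integral_integrable intro!: integrable_on_mult_right)
    show "((\<lambda>s. s\<^sup>2) has_real_derivative 2 * s) (at s)" for s :: real
      by (auto intro!: derivative_eq_intros)
  qed (intro continuous_intros c\<rho> c\<phi>)+
  have i1: "(\<lambda>t. \<rho> t * \<phi>' t) integrable_on {a..b}"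
    by (intro integrable_continuous_interval continuous_intros c\<rho> c\<phi>'')
  have i2: "(\<lambda>t. v t * \<phi> t) integrable_on {a..b}"
    using absolutely_integrable_continuous_mult[OF c\<phi> v] by (simp add: absolutely_integrable_on_def mult.commute)
  have i3: "(\<lambda>t. 2 * (\<rho> t + k * \<phi> t) * (v t + k * \<phi>' t)) integrable_on {a..b}" for k
  proof -
    have "(\<lambda>t. 2 * (\<rho> t + k * \<phi> t) * (v t + k * \<phi>' t)) absolutely_integrable_on {a..b}"
      using v a\<phi> by (intro absolutely_integrable_continuous_mult continuous_intros c\<rho> c\<phi> set_integral_add set_integrable_mult_right) auto
    then show ?thesis by (simp add: absolutely_integrable_on_def)
  qed
  have "4 * (integral {a..b} (\<lambda>t. \<rho> t * \<phi>' t) + integral {a..b} (\<lambda>t. v t * \<phi> t))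
     = integral {a..b} (\<lambda>t. 4 * (\<rho> t * \<phi>' t + v t * \<phi> t))"
    using i1 i2 by (simp add: Henstock_Kurzweil_Integration.integral_add)
  also have "\<dots> = integral {a..b} (\<lambda>t. 2 * (\<rho> t + 1 * \<phi> t) * (v t + 1 * \<phi>' t) - 2 * (\<rho> t + (-1) * \<phi> t) * (v t + (-1) * \<phi>' t))"
    by (intro integral_cong) (simp add: algebra_simps)
  also have "\<dots> = 4 * (\<rho> b * \<phi> b - \<rho> a * \<phi> a)"
    by (subst Henstock_Kurzweil_Integration.integral_diff[OF i3 i3], subst (1 2) key)
      (simp add: power2_eq_square algebra_simps)
  finally show ?thesis by simp
qed

section \<open>Test functions\<close>

lemma C1_differentiable_on_UNIV_D:
  fixes \<phi> :: "real \<Rightarrow> real"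
  assumes "\<phi> C1_differentiable_on UNIV"
  shows "(\<phi> has_real_derivative deriv \<phi> x) (at x)" "continuous_on UNIV (deriv \<phi>)"
proof -
  from assms obtain D where D: "\<And>x. (\<phi> has_vector_derivative D x) (at x)" "continuous_on UNIV D"
    by (auto simp: C1_differentiable_on_def)
  then have d: "(\<phi> has_real_derivative D x) (at x)" for x
    by (simp add: has_real_derivative_iff_has_vector_derivative)
  then have "deriv \<phi> = D" by (auto intro: DERIV_imp_deriv)
  with d D show "(\<phi> has_real_derivative deriv \<phi> x) (at x)" "continuous_on UNIV (deriv \<phi>)" by auto
qed

lemma C1c_Ioo_I:
  fixes \<phi> \<phi>' :: "real \<Rightarrow> real"
  assumes \<phi>: "\<And>s. (\<phi> has_real_derivative \<phi>' s) (at s)" and c: "continuous_on UNIV \<phi>'"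
    and z: "\<And>s. s \<notin> {c..d} \<Longrightarrow> \<phi> s = 0" and "a < c" "d < b"
  shows "\<phi> \<in> C1c {a<..<b}"
proof -
  have "closure {x. \<phi> x \<noteq> 0} \<subseteq> {c..d}"
    by (rule closure_minimal) (use z in blast, simp)
  moreover from this have "compact (closure {x. \<phi> x \<noteq> 0})"
    using bounded_subset[OF bounded_closed_interval] by (auto simp: compact_eq_bounded_closed)
  moreover have "\<phi> C1_differentiable_on UNIV"
    using \<phi> c by (auto simp: C1_differentiable_on_def has_real_derivative_iff_has_vector_derivative)
  ultimately show ?thesis
    using assms(4,5) by (auto simp: C1c_def)
qed

lemma C1c_Ioo_support:
  assumes \<phi>: "\<phi> \<in> C1c {a<..<b}" and ab: "a < b"
  obtains c d where "a < c" "c < d" "d < b" "\<And>x. x \<notin> {c<..<d} \<Longrightarrow> \<phi> x = 0 \<and> deriv \<phi> x = 0"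
proof -
  define K where "K = closure {x. \<phi> x \<noteq> 0}"
  have K: "compact K" "K \<subseteq> {a<..<b}" using \<phi> by (auto simp: C1c_def K_def)
  have out: "\<phi> x = 0 \<and> deriv \<phi> x = 0" if "x \<notin> K" for x
  proof -
    have z: "\<phi> y = 0" if "y \<in> - K" for y
      using that closure_subset[of "{x. \<phi> x \<noteq> 0}"] by (auto simp: K_def)
    have "open (- K)" using K(1) by (simp add: compact_imp_closed open_Compl)
    have "(\<phi> has_real_derivative 0) (at x)"
      by (rule has_field_derivative_transform_within_open[OF DERIV_const[of 0], of "- K"])
        (use that z \<open>open (- K)\<close> in auto)
    then show ?thesis using z[of x] that by (auto intro: DERIV_imp_deriv)
  qed
  obtain m M where m: "a < m" "m \<le> M" "M < b" "K \<subseteq> {m..M}"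
  proof (cases "K = {}")
    case True
    then show thesis using that[of "(a+b)/2" "(a+b)/2"] ab by auto
  next
    case False
    obtain m where m: "m \<in> K" "\<And>x. x \<in> K \<Longrightarrow> m \<le> x"
      using compact_attains_inf[OF K(1) False] by blast
    obtain M where M: "M \<in> K" "\<And>x. x \<in> K \<Longrightarrow> x \<le> M"
      using compact_attains_sup[OF K(1) False] by blast
    have "K \<subseteq> {m..M}" using m(2) M(2) by auto
    moreover have "a < m" "m \<le> M" "M < b" using m M K(2) by auto
    ultimately show thesis using that by blast
  qed
  \<comment> \<open>Going halfway from the support to each end point makes the interval
    nondegenerate even if \<open>m = M\<close>, as happens for the zero function.\<close>
  show thesis
  proof (rule that[of "(a+m)/2" "(M+b)/2"])
    fix x assume "x \<notin> {(a+m)/2<..<(M+b)/2}"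
    then have "x \<notin> K" using m by auto
    then show "\<phi> x = 0 \<and> deriv \<phi> x = 0" by (rule out)
  qed (use m in auto)
qed

text \<open>A \<open>C\<^sup>1\<close> transition from \<open>0\<close> on the negative axis to \<open>1\<close> beyond \<open>1\<close>, whose derivative is
  a tent function.\<close>

definition ramp :: "real \<Rightarrow> real" where
  "ramp t = 2 * (max 0 t)\<^sup>2 - 4 * (max 0 (t - 1/2))\<^sup>2 + 2 * (max 0 (t - 1))\<^sup>2"

definition tent :: "real \<Rightarrow> real" where
  "tent t = 4 * max 0 t - 8 * max 0 (t - 1/2) + 4 * max 0 (t - 1)"

text \<open>Squares of truncations are the building blocks of \<open>ramp\<close>: unlike the
  truncations themselves they are differentiable at the kink, where the difference quotient is at
  most |h|.\<close>

lemma has_real_derivative_max_0_squared: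
  "((\<lambda>t::real. (max 0 t)\<^sup>2) has_real_derivative 2 * max 0 t) (at t)"
proof (cases t "0::real" rule: linorder_cases)
  case less
  have "((\<lambda>t::real. (max 0 t)\<^sup>2) has_real_derivative 0) (at t)"
    by (rule has_field_derivative_transform_within_open[OF DERIV_const[of 0], of "{..<0}"]) (use less in auto)
  then show ?thesis using less by simp
next
  case equal
  have "((\<lambda>h::real. (max 0 h)\<^sup>2 / h) \<longlongrightarrow> 0) (at 0)"
  proof (rule Lim_null_comparison)
    show "\<forall>\<^sub>F h in at 0. norm ((max 0 h)\<^sup>2 / h) \<le> \<bar>h\<bar>"
      by (auto simp: eventually_at power2_eq_square max_def intro!: exI[of _ 1])
    show "((\<lambda>h::real. \<bar>h\<bar>) \<longlongrightarrow> 0) (at 0)"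
      by (rule tendsto_eq_intros | simp)+
  qed
  then show ?thesis using equal by (simp add: DERIV_def)
next
  case greater
  have "((\<lambda>t::real. t\<^sup>2) has_real_derivative 2 * t) (at t)"
    by (auto intro!: derivative_eq_intros)
  then have "((\<lambda>t::real. (max 0 t)\<^sup>2) has_real_derivative 2 * t) (at t)"
    by (rule has_field_derivative_transform_within_open[of _ _ _ "{0<..}"]) (use greater in auto)
  then show ?thesis using greater by simp
qed

lemma ramp_deriv: "(ramp has_real_derivative tent t) (at t)"
proof -
  have sh: "((\<lambda>t. (max 0 (t - c))\<^sup>2) has_real_derivative 2 * max 0 (t - c)) (at t)" for c :: real
    by (rule DERIV_chain2[OF has_real_derivative_max_0_squared, of "\<lambda>t. t - c" 1 t, simplified])
      (rule derivative_eq_intros | simp)+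
  note s = sh[of 0, simplified] sh[of "1/2"] sh[of 1]
  show ?thesis
    unfolding ramp_def[abs_def] tent_def
    by (rule derivative_eq_intros s refl)+ simp
qed

lemma continuous_on_tent [continuous_intros]:
  assumes "continuous_on A f"
  shows "continuous_on A (\<lambda>t. tent (f t))"
  unfolding tent_def by (intro continuous_intros assms)

lemma tent_nonneg: "tent t \<ge> 0" and tent_eq_0: "t \<le> 0 \<or> t \<ge> 1 \<Longrightarrow> tent t = 0"
  by (auto simp: tent_def max_def)

lemma ramp_eq_0: "t \<le> 0 \<Longrightarrow> ramp t = 0" and ramp_eq_1: "t \<ge> 1 \<Longrightarrow> ramp t = 1"
  by (auto simp: ramp_def max_def power2_eq_square algebra_simps)

lemma ramp_mono: "s \<le> t \<Longrightarrow> ramp s \<le> ramp t"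
  by (rule DERIV_nonneg_imp_nondecreasing) (auto intro: ramp_deriv tent_nonneg)

lemma ramp_bounds: "0 \<le> ramp t" "ramp t \<le> 1"
  using ramp_mono[of "min t 0" t] ramp_mono[of t "max t 1"] by (auto simp: ramp_eq_0 ramp_eq_1)

lemma ramp_scaled_deriv:
  "((\<lambda>t. ramp ((t - p) / h)) has_real_derivative tent ((t - p) / h) / h) (at t)"
proof -
  have "((\<lambda>t. (t - p) / h) has_real_derivative 1 / h) (at t)"
    by (cases "h = 0") (auto intro!: derivative_eq_intros simp: field_simps)
  from DERIV_chain2[OF ramp_deriv this] show ?thesis by simp
qed

text \<open>The rescaled tents form an approximate identity supported to the right of p, with mass 1
  because \<open>ramp\<close> climbs from 0 to 1. Being one-sided, they also work at the left end
  point \<open>p = x\<close>.\<close>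

lemma tent_kernel_limit:
  assumes c: "continuous_on {x..d} \<rho>" and p: "x \<le> p" "p < d" and h: "\<And>n. h n > 0" "h \<longlonglongrightarrow> 0"
  shows "(\<lambda>n. integral {x..d} (\<lambda>t. \<rho> t * (tent ((t - p) / h n) / h n))) \<longlonglongrightarrow> \<rho> p"
proof (rule LIMSEQ_I)
  fix r :: real assume r: "r > 0"
  have "p \<in> {x..d}" "r / 2 > 0" using p r by auto
  from c[unfolded continuous_on_iff, rule_format, OF this]
  obtain \<delta> where \<delta>: "\<delta> > 0" "\<And>t. t \<in> {x..d} \<Longrightarrow> dist t p < \<delta> \<Longrightarrow> dist (\<rho> t) (\<rho> p) < r / 2"
    by blast
  \<comment> \<open>Width below \<delta> keeps the tent where \<rho> is close to
    \<open>\<rho> p\<close>; width below \<open>d - p\<close> keeps its whole mass inside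
    \<open>{x..d}\<close>.\<close>
  have "\<forall>\<^sub>F n in sequentially. h n < min \<delta> (d - p)"
    using h(2) \<delta>(1) p by (intro order_tendstoD) auto
  then obtain N where N: "\<And>n. n \<ge> N \<Longrightarrow> h n < min \<delta> (d - p)" by (auto simp: eventually_sequentially)
  show "\<exists>N. \<forall>n\<ge>N. norm (integral {x..d} (\<lambda>t. \<rho> t * (tent ((t - p) / h n) / h n)) - \<rho> p) < r"
  proof (intro exI[of _ N] allI impI)
    fix n assume n: "n \<ge> N"
    define K where "K = (\<lambda>t. tent ((t - p) / h n) / h n)"
    have Kc: "continuous_on A K" for A unfolding K_def using h(1)[of n] by (intro continuous_intros) auto
    have K0: "K t \<ge> 0" for t using h(1)[of n] by (simp add: K_def tent_nonneg)
    have Kint: "(K has_integral 1) {x..d}"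
    proof -
      have "(K has_integral ramp ((d - p) / h n) - ramp ((x - p) / h n)) {x..d}"
        using p ramp_scaled_deriv[of p "h n"] unfolding K_def
        by (intro fundamental_theorem_of_calculus)
          (auto simp: has_real_derivative_iff_has_vector_derivative[symmetric] intro: DERIV_subset)
      moreover have "ramp ((d - p) / h n) = 1" using N[OF n] h(1)[of n] by (intro ramp_eq_1) (auto simp: field_simps)
      moreover have "ramp ((x - p) / h n) = 0" using p h(1)[of n] by (intro ramp_eq_0) (auto simp: divide_le_0_iff)
      ultimately show ?thesis by simp
    qed
    have i1: "(\<lambda>t. \<rho> t * K t) integrable_on {x..d}"
      by (intro integrable_continuous_interval continuous_on_mult c Kc)
    have i2: "(\<lambda>t. k * K t) integrable_on {x..d}" for k
      using Kint by (intro integrable_on_mult_right) (rule has_integral_integrable)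
    have i3: "(\<lambda>t. (\<rho> t - \<rho> p) * K t) integrable_on {x..d}"
      using integrable_diff[OF i1 i2[of "\<rho> p"]] by (simp add: left_diff_distrib)
    have "integral {x..d} (\<lambda>t. \<rho> t * K t) - \<rho> p = integral {x..d} (\<lambda>t. \<rho> t * K t) - integral {x..d} (\<lambda>t. \<rho> p * K t)"
      using Kint by (simp add: integral_unique)
    also have "\<dots> = integral {x..d} (\<lambda>t. (\<rho> t - \<rho> p) * K t)"
      unfolding left_diff_distrib by (rule Henstock_Kurzweil_Integration.integral_diff[OF i1 i2, symmetric])
    also have "norm \<dots> \<le> integral {x..d} (\<lambda>t. r / 2 * K t)"
    proof (rule integral_norm_bound_integral)
      fix t assume t: "t \<in> {x..d}"
      show "norm ((\<rho> t - \<rho> p) * K t) \<le> r / 2 * K t"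
      proof (cases "t \<le> p \<and> t \<noteq> p \<or> t \<ge> p + h n")
        case True
        then have "K t = 0" unfolding K_def using h(1)[of n] by (subst tent_eq_0) (auto simp: field_simps)
        then show ?thesis by simp
      next
        case False
        then have "dist t p < \<delta>" using N[OF n] by (auto simp: dist_real_def)
        then have "\<bar>\<rho> t - \<rho> p\<bar> \<le> r / 2" using \<delta>(2)[OF t] by (auto simp: dist_real_def)
        then show ?thesis using mult_right_mono[OF _ K0[of t]] K0[of t] by (fastforce simp: abs_mult)
      qed
    qed (rule i3 i2)+
    also have "\<dots> = r / 2" using Kint by (simp add: integral_unique)
    finally show "norm (integral {x..d} (\<lambda>t. \<rho> t * (tent ((t - p) / h n) / h n)) - \<rho> p) < r"
      using r by (simp add: K_def)
  qed
qed

section \<open>Weak derivatives\<close>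

lemma integral_lebesgue_on_eq_if_zero_outside:
  fixes f :: "real \<Rightarrow> real"
  assumes "f absolutely_integrable_on {c..d}" "{c..d} \<subseteq> S" "S \<in> sets lebesgue" "\<And>x. x \<notin> {c..d} \<Longrightarrow> f x = 0"
  shows "(\<integral>x. f x \<partial>lebesgue_on S) = integral {c..d} f"
proof -
  have "(\<integral>x. f x \<partial>lebesgue_on S) = (\<integral>x. (if x \<in> S then f x else 0) \<partial>lebesgue)"
    by (simp add: Lebesgue_Measure.integral_restrict_UNIV assms)
  also have "(\<lambda>x. if x \<in> S then f x else 0) = (\<lambda>x. if x \<in> {c..d} then f x else 0)"
    using assms by fastforce
  also have "(\<integral>x. (if x \<in> {c..d} then f x else 0) \<partial>lebesgue) = (\<integral>x. f x \<partial>lebesgue_on {c..d})"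
    by (rule Lebesgue_Measure.integral_restrict_UNIV) auto
  also have "\<dots> = integral {c..d} f"
    using assms by (intro lebesgue_integral_eq_integral) (auto simp: integrable_lebesgue_on_Icc_iff)
  finally show ?thesis .
qed

lemma loc_integrable_onD:
  "loc_integrable_on u S \<Longrightarrow> {c..d} \<subseteq> S \<Longrightarrow> u absolutely_integrable_on {c..d}"
  by (auto simp: loc_integrable_on_def integrable_lebesgue_on_Icc_iff[symmetric])

lemma loc_integrable_on_if_integrable:
  assumes "integrable (lebesgue_on S) u" "S \<in> sets lebesgue"
  shows "loc_integrable_on u S"
  unfolding loc_integrable_on_def
proof safe
  fix K assume K: "compact K" "K \<subseteq> S"
  have "set_integrable lebesgue S u"
    using assms by (simp add: set_integrable_def integrable_restrict_space)
  moreover have "K \<in> sets lebesgue" using K by (simp add: borel_compact)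
  ultimately have "set_integrable lebesgue K u" using K(2) by (rule set_integrable_subset)
  then show "integrable (lebesgue_on K) u" using K \<open>K \<in> sets lebesgue\<close>
    by (simp add: set_integrable_def integrable_restrict_space)
qed

lemma has_weak_deriv_test:
  fixes \<phi> \<phi>' :: "real \<Rightarrow> real"
  assumes w: "has_weak_deriv {a<..<b} u v" and cd: "a < c" "d < b"
    and \<phi>: "\<And>s. (\<phi> has_real_derivative \<phi>' s) (at s)" and c: "continuous_on UNIV \<phi>'"
    and z: "\<And>s. s \<notin> {c..d} \<Longrightarrow> \<phi> s = 0" "\<And>s. s \<notin> {c..d} \<Longrightarrow> \<phi>' s = 0"
  shows "integral {c..d} (\<lambda>x. u x * \<phi>' x) = - integral {c..d} (\<lambda>x. v x * \<phi> x)"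
proof -
  have "\<phi> \<in> C1c {a<..<b}" by (rule C1c_Ioo_I[OF \<phi> c z(1) cd])
  moreover have "deriv \<phi> = \<phi>'" using \<phi> by (auto intro: DERIV_imp_deriv)
  ultimately have eq: "(\<integral>x. u x * \<phi>' x \<partial>lebesgue_on {a<..<b}) = - (\<integral>x. v x * \<phi> x \<partial>lebesgue_on {a<..<b})"
    using w by (auto simp: has_weak_deriv_def)
  have sub: "{c..d} \<subseteq> {a<..<b}" using cd by auto
  have uv: "u absolutely_integrable_on {c..d}" "v absolutely_integrable_on {c..d}"
    using w loc_integrable_onD[OF _ sub] by (auto simp: has_weak_deriv_def)
  have c\<phi>: "continuous_on {c..d} \<phi>"
    using \<phi> by (meson DERIV_continuous_on DERIV_subset top_greatest)
  have c\<phi>': "continuous_on {c..d} \<phi>'" using c continuous_on_subset by blast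
  have i: "(\<lambda>x. u x * \<phi>' x) absolutely_integrable_on {c..d}" "(\<lambda>x. v x * \<phi> x) absolutely_integrable_on {c..d}"
    using absolutely_integrable_continuous_mult[OF c\<phi>' uv(1)] absolutely_integrable_continuous_mult[OF c\<phi> uv(2)]
    by (simp_all add: mult.commute)
  have "(\<integral>x. u x * \<phi>' x \<partial>lebesgue_on {a<..<b}) = integral {c..d} (\<lambda>x. u x * \<phi>' x)"
    by (rule integral_lebesgue_on_eq_if_zero_outside[OF i(1) sub]) (use z(2) in simp_all)
  moreover have "(\<integral>x. v x * \<phi> x \<partial>lebesgue_on {a<..<b}) = integral {c..d} (\<lambda>x. v x * \<phi> x)"
    by (rule integral_lebesgue_on_eq_if_zero_outside[OF i(2) sub]) (use z(1) in simp_all)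
  ultimately show ?thesis using eq by simp
qed

lemma AE_lebesgue_onE:
  fixes S :: "real set"
  assumes "AE x in lebesgue_on S. P x" "S \<in> sets lebesgue"
  obtains N where "negligible N" "\<And>x. x \<in> S \<Longrightarrow> x \<notin> N \<Longrightarrow> P x"
proof -
  have "AE x in lebesgue. x \<in> S \<longrightarrow> P x" using assms by (simp add: AE_restrict_space_iff)
  then obtain N where "negligible N" "{x. \<not> (x \<in> S \<longrightarrow> P x)} \<subseteq> N"
    unfolding eventually_ae_filter_negligible by blast
  then show thesis using that by blast
qed

text \<open>The test functions are differences of two steep ramps, one starting at x and one at y.
  They approximate the indicator of the interval between x and y, while their derivatives are two
  tent kernels that evaluate \<rho> at x and at y.\<close>

lemma has_weak_deriv_increment_interior:
  assumes w: "has_weak_deriv {a<..<b} u v" and u: "AE x in lebesgue_on {a<..<b}. u x = \<rho> x"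
    and c: "continuous_on {a<..<b} \<rho>" and xy: "a < x" "x \<le> y" "y < b"
  shows "integral {x..y} v = \<rho> y - \<rho> x"
proof -
  \<comment> \<open>The midpoint leaves room to the right of y for the second ramp. The widths h
    start at \<open>h 0 = d - y\<close>, so every ramp is completed before d.\<close>
  define d where "d = (y + b) / 2"
  define h where "h = (\<lambda>n. (b - y) / 2 / real (Suc n))"
  have d: "y < d" "d < b" using xy by (auto simp: d_def)
  have h0: "h n > 0" for n using xy by (simp add: h_def)
  have h_le: "h n \<le> d - y" for n
  proof -
    have "h n \<le> (b - y) / 2 / 1" unfolding h_def using xy by (intro divide_left_mono) auto
    also have "\<dots> = d - y" by (simp add: d_def field_simps)
    finally show ?thesis .
  qed
  have h_lim: "h \<longlonglongrightarrow> 0"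
    unfolding h_def by (rule LIMSEQ_Suc, rule lim_const_over_n)
  have sub: "{x..d} \<subseteq> {a<..<b}" using xy d by auto
  have c': "continuous_on {x..d} \<rho>" by (rule continuous_on_subset[OF c sub])
  define \<phi> where "\<phi> = (\<lambda>n t. ramp ((t - x) / h n) - ramp ((t - y) / h n))"
  define \<phi>' where "\<phi>' = (\<lambda>n t. tent ((t - x) / h n) / h n - tent ((t - y) / h n) / h n)"
  have \<phi>: "(\<phi> n has_real_derivative \<phi>' n s) (at s)" for n s
    unfolding \<phi>_def \<phi>'_def by (intro derivative_intros ramp_scaled_deriv)
  have c\<phi>': "continuous_on A (\<phi>' n)" for n A
    unfolding \<phi>'_def using h0[of n] by (intro continuous_intros) auto
  have c\<phi>: "continuous_on A (\<phi> n)" for n A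
    using \<phi> by (meson DERIV_continuous_on DERIV_subset top_greatest)
  have z: "\<phi> n s = 0 \<and> \<phi>' n s = 0" if "s \<notin> {x..d}" for n s
  proof (cases "s < x")
    case True
    then have "(s - x) / h n \<le> 0" "(s - y) / h n \<le> 0" using h0[of n] xy by (auto simp: divide_le_0_iff)
    then show ?thesis by (simp add: \<phi>_def \<phi>'_def ramp_eq_0 tent_eq_0)
  next
    case False
    then have "(s - x) / h n \<ge> 1" "(s - y) / h n \<ge> 1" using h0[of n] h_le[of n] xy that by (auto simp: field_simps)
    then show ?thesis by (simp add: \<phi>_def \<phi>'_def ramp_eq_1 tent_eq_0)
  qed
  have v: "v absolutely_integrable_on {x..d}"
    using w sub loc_integrable_onD by (auto simp: has_weak_deriv_def)
  have eq: "integral {x..d} (\<lambda>t. \<rho> t * (tent ((t - x) / h n) / h n)) - integral {x..d} (\<lambda>t. \<rho> t * (tent ((t - y) / h n) / h n))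
      = - integral {x..d} (\<lambda>t. v t * \<phi> n t)" for n
  proof -
    have hn: "h n \<noteq> 0" using h0[of n] by simp
    have "integral {x..d} (\<lambda>t. \<rho> t * (tent ((t - x) / h n) / h n)) - integral {x..d} (\<lambda>t. \<rho> t * (tent ((t - y) / h n) / h n))
      = integral {x..d} (\<lambda>t. \<rho> t * \<phi>' n t)"
      unfolding \<phi>'_def right_diff_distrib
      by (rule Henstock_Kurzweil_Integration.integral_diff[symmetric])
         (use hn in \<open>auto intro!: integrable_continuous_interval continuous_intros c'\<close>)
    also have "\<dots> = integral {x..d} (\<lambda>t. u t * \<phi>' n t)"
    proof -
      obtain N where "negligible N" "\<And>t. t \<in> {a<..<b} \<Longrightarrow> t \<notin> N \<Longrightarrow> u t = \<rho> t"
        using AE_lebesgue_onE[OF u] by auto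
      then show ?thesis using sub by (intro integral_spike[of N]) auto
    qed
    also have "\<dots> = - integral {x..d} (\<lambda>t. v t * \<phi> n t)"
      using xy d z by (intro has_weak_deriv_test[OF w _ _ \<phi> c\<phi>']) auto
    finally show ?thesis .
  qed
  have L: "(\<lambda>n. - integral {x..d} (\<lambda>t. v t * \<phi> n t)) \<longlonglongrightarrow> \<rho> x - \<rho> y"
    using xy d unfolding eq[symmetric]
    by (intro tendsto_diff tent_kernel_limit[OF c' _ _ h0 h_lim]) auto
  \<comment> \<open>The pointwise limit of \<open>\<phi> n\<close> is the indicator of the half-open
    interval from x (excluded) to y (included). It differs from that of \<open>{x..y}\<close> only
    at x.\<close>
  define \<kappa> where "\<kappa> = (\<lambda>t. (if t > x then 1 else 0) - (if t > y then 1 else (0::real)))"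
  have ramp_lim: "(\<lambda>n. ramp ((t - p) / h n)) \<longlonglongrightarrow> (if t > p then 1 else 0)" for t p
  proof (cases "t > p")
    case True
    have "\<forall>\<^sub>F n in sequentially. h n < t - p" using True h_lim by (intro order_tendstoD) auto
    then have "\<forall>\<^sub>F n in sequentially. ramp ((t - p) / h n) = 1"
      by eventually_elim (use h0 in \<open>auto intro!: ramp_eq_1 simp: field_simps intro: less_imp_le\<close>)
    then show ?thesis using True by (simp add: tendsto_eventually)
  next
    case False
    then have "(t - p) / h n \<le> 0" for n using h0[of n] by (auto simp: divide_le_0_iff)
    then show ?thesis using False by (simp add: ramp_eq_0)
  qed
  have "(\<lambda>n. integral {x..d} (\<lambda>t. v t * \<phi> n t)) \<longlonglongrightarrow> integral {x..d} (\<lambda>t. v t * \<kappa> t)"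
  proof (rule dominated_convergence(2))
    show "(\<lambda>t. v t * \<phi> n t) integrable_on {x..d}" for n
      using absolutely_integrable_continuous_mult[OF c\<phi> v] by (simp add: absolutely_integrable_on_def mult.commute)
    show "(\<lambda>t. \<bar>v t\<bar>) integrable_on {x..d}"
      using v by (simp add: absolutely_integrable_on_def)
    show "norm (v t * \<phi> n t) \<le> \<bar>v t\<bar>" for t n
    proof -
      have "\<bar>\<phi> n t\<bar> \<le> 1"
        using ramp_bounds[of "(t - x) / h n"] ramp_bounds[of "(t - y) / h n"] by (simp add: \<phi>_def)
      then show ?thesis using mult_left_mono[of "\<bar>\<phi> n t\<bar>" 1 "\<bar>v t\<bar>"] by (simp add: abs_mult)
    qed
    show "(\<lambda>n. v t * \<phi> n t) \<longlonglongrightarrow> v t * \<kappa> t" for t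
      unfolding \<phi>_def \<kappa>_def by (intro tendsto_intros ramp_lim)
  qed
  also have "integral {x..d} (\<lambda>t. v t * \<kappa> t) = integral {x..d} (\<lambda>t. if t \<in> {x..y} then v t else 0)"
    by (rule integral_spike[of "{x}"]) (auto simp: \<kappa>_def)
  also have "\<dots> = integral {x..y} v"
    using d integral_restrict_Int[of "{x..d}" "{x..y}" v] by (simp add: Int_absorb1 min_absorb1)
  finally have "(\<lambda>n. - integral {x..d} (\<lambda>t. v t * \<phi> n t)) \<longlonglongrightarrow> - integral {x..y} v" by (rule tendsto_minus)
  from LIMSEQ_unique[OF this L] show ?thesis by simp
qed

text \<open>The difference of the indefinite integral of v and \<rho> is constant in the interior by
  the previous lemma. It is continuous up to the end points because v is integrable on
  \<open>{a..b}\<close>, so the constant persists there.\<close>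

lemma has_weak_deriv_increment:
  assumes w: "has_weak_deriv {a<..<b} u v" and u: "AE x in lebesgue_on {a<..<b}. u x = \<rho> x"
    and c: "continuous_on {a..b} \<rho>" and v: "v absolutely_integrable_on {a..b}"
    and ab: "a < b" and xy: "a \<le> x" "x \<le> y" "y \<le> b"
  shows "integral {x..y} v = \<rho> y - \<rho> x"
proof -
  define m where "m = (a + b) / 2"
  have m: "a < m" "m < b" using ab by (auto simp: m_def)
  have iv: "v integrable_on {a..b}" using v by (simp add: absolutely_integrable_on_def)
  define f where "f = (\<lambda>t. integral {a..t} v - \<rho> t)"
  have cf: "continuous_on {a..b} f"
    unfolding f_def by (intro continuous_intros c indefinite_integral_continuous_1[OF iv])
  have comb: "integral {a..t} v - integral {a..s} v = integral {s..t} v" if "a \<le> s" "s \<le> t" "t \<le> b" for s t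
    using Henstock_Kurzweil_Integration.integral_combine[of a s t v] that integrable_on_subinterval[OF iv, of a t] by auto
  have "f t = f m" if "t \<in> {a<..<b}" for t
  proof -
    have inc: "integral {p..q} v = \<rho> q - \<rho> p" if "a < p" "p \<le> q" "q < b" for p q
      by (rule has_weak_deriv_increment_interior[OF w u continuous_on_subset[OF c] that]) auto
    show ?thesis
      using comb[of t m] comb[of m t] inc[of t m] inc[of m t] that m by (cases "t \<le> m") (auto simp: f_def)
  qed
  then have "f t = f m" if "t \<in> {a..b}" for t
    using continuous_constant_on_closure[of "{a<..<b}" f "f m" t] that ab cf
    by (simp add: closure_greaterThanLessThan)
  then have "f x = f m" "f y = f m" using xy by auto
  then show ?thesis using comb[OF xy] by (simp add: f_def)
qed

text \<open>The difference of two weak derivatives of u is a weak derivative of 0, so its integrals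
  over compact subintervals vanish. Both are only locally integrable, hence the exhaustion by
  compact intervals.\<close>

lemma has_weak_deriv_unique:
  assumes "has_weak_deriv {a<..<b} u v" "has_weak_deriv {a<..<b} u v'" and ab: "a < b"
  shows "AE x in lebesgue_on {a<..<b}. v x = v' x"
proof -
  have lu: "loc_integrable_on u {a<..<b}" and lv: "loc_integrable_on v {a<..<b}" and lv': "loc_integrable_on v' {a<..<b}"
    using assms by (auto simp: has_weak_deriv_def)
  have w: "has_weak_deriv {a<..<b} (\<lambda>_. 0) (\<lambda>x. v x - v' x)"
    unfolding has_weak_deriv_def
  proof (intro conjI ballI)
    show "loc_integrable_on (\<lambda>_. 0) {a<..<b}" by (simp add: loc_integrable_on_def)
    show "loc_integrable_on (\<lambda>x. v x - v' x) {a<..<b}" using lv lv' by (auto simp: loc_integrable_on_def)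
    fix \<phi> assume \<phi>: "\<phi> \<in> C1c {a<..<b}"
    obtain c d where cd: "a < c" "c < d" "d < b" and z: "\<And>x. x \<notin> {c<..<d} \<Longrightarrow> \<phi> x = 0 \<and> deriv \<phi> x = 0"
      using C1c_Ioo_support[OF \<phi> ab] by blast
    have sub: "{c..d} \<subseteq> {a<..<b}" using cd by auto
    have c\<phi>: "continuous_on {c..d} \<phi>"
      using \<phi> C1_differentiable_on_UNIV_D(1) by (metis (mono_tags, lifting) C1c_def DERIV_continuous_on DERIV_subset mem_Collect_eq top_greatest)
    have i: "(\<lambda>x. v x * \<phi> x) absolutely_integrable_on {c..d}" "(\<lambda>x. v' x * \<phi> x) absolutely_integrable_on {c..d}"
      using absolutely_integrable_continuous_mult[OF c\<phi> loc_integrable_onD[OF lv sub]]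
         absolutely_integrable_continuous_mult[OF c\<phi> loc_integrable_onD[OF lv' sub]] by (auto simp: mult.commute)
    have ii: "(\<lambda>x. (v x - v' x) * \<phi> x) absolutely_integrable_on {c..d}"
      using set_integral_diff(1)[OF i] by (simp add: left_diff_distrib)
    have "(\<integral>x. (v x - v' x) * \<phi> x \<partial>lebesgue_on {a<..<b}) = integral {c..d} (\<lambda>x. v x * \<phi> x - v' x * \<phi> x)"
      using ii sub z by (subst integral_lebesgue_on_eq_if_zero_outside[where c = c and d = d]) (auto simp: left_diff_distrib)
    also have "\<dots> = integral {c..d} (\<lambda>x. v x * \<phi> x) - integral {c..d} (\<lambda>x. v' x * \<phi> x)"
      using i by (intro Henstock_Kurzweil_Integration.integral_diff) (auto simp: absolutely_integrable_on_def)
    also have "integral {c..d} (\<lambda>x. v x * \<phi> x) = (\<integral>x. v x * \<phi> x \<partial>lebesgue_on {a<..<b})"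
      using i(1) sub z by (subst integral_lebesgue_on_eq_if_zero_outside[where c = c and d = d]) auto
    also have "integral {c..d} (\<lambda>x. v' x * \<phi> x) = (\<integral>x. v' x * \<phi> x \<partial>lebesgue_on {a<..<b})"
      using i(2) sub z by (subst integral_lebesgue_on_eq_if_zero_outside[where c = c and d = d]) auto
    also have "(\<integral>x. v x * \<phi> x \<partial>lebesgue_on {a<..<b}) = (\<integral>x. v' x * \<phi> x \<partial>lebesgue_on {a<..<b})"
      using assms \<phi> by (auto simp: has_weak_deriv_def)
    finally show "(\<integral>x. 0 * deriv \<phi> x \<partial>lebesgue_on {a<..<b}) = - (\<integral>x. (v x - v' x) * \<phi> x \<partial>lebesgue_on {a<..<b})" by simp
  qed
  \<comment> \<open>The compact intervals start at the midpoint alone (n = 0) and increase to the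
    open interval.\<close>
  define c d where "c = (\<lambda>n. a + (b - a) / 2 / real (Suc n))" and "d = (\<lambda>n. b - (b - a) / 2 / real (Suc n))"
  have cd: "a < c n" "d n < b" for n using ab by (auto simp: c_def d_def)
  have *: "AE x in lebesgue_on {c n..d n}. v x - v' x = 0" for n
  proof (rule AE_zero_if_interval_integrals_zero)
    show "(\<lambda>x. v x - v' x) absolutely_integrable_on {c n..d n}"
      using w cd[of n] by (intro loc_integrable_onD[of _ "{a<..<b}"]) (auto simp: has_weak_deriv_def)
    show "integral {p..q} (\<lambda>x. v x - v' x) = 0" if "c n \<le> p" "p \<le> q" "q \<le> d n" for p q
      using has_weak_deriv_increment_interior[OF w, of "\<lambda>_. 0" p q] cd[of n] that by auto
  qed
  have "AE x in lebesgue. \<forall>n. x \<in> {c n..d n} \<longrightarrow> v x - v' x = 0"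
    unfolding AE_all_countable using * by (simp add: AE_restrict_space_iff)
  moreover have "\<exists>n. x \<in> {c n..d n}" if "x \<in> {a<..<b}" for x
  proof -
    have "min (x - a) (b - x) / ((b - a) / 2) > 0" using that by auto
    from reals_Archimedean[OF this] obtain n where "inverse (real (Suc n)) < min (x - a) (b - x) / ((b - a) / 2)" ..
    then have "inverse (real (Suc n)) * ((b - a) / 2) < min (x - a) (b - x)"
      using ab by (simp only: pos_less_divide_eq half_gt_zero_iff diff_gt_0_iff_gt)
    then have "(b - a) / 2 / real (Suc n) < min (x - a) (b - x)"
      by (simp only: divide_inverse mult.commute)
    then show ?thesis by (intro exI[of _ n]) (auto simp: c_def d_def)
  qed
  ultimately show ?thesis
    by (simp add: AE_restrict_space_iff) (force elim: eventually_mono)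
qed

lemma has_weak_deriv_weak_deriv: "has_weak_deriv S u v \<Longrightarrow> has_weak_deriv S u (weak_deriv S u)"
  unfolding weak_deriv_def by (rule someI[of "has_weak_deriv S u"])

section \<open>Limits of periodic functions of bounded variation\<close>

text \<open>This is lower semicontinuity of the variation in dual form. For a fixed \<phi> the error
  made by replacing \<open>w j\<close> by u is at most the maximum of
  \<open>\<bar>\<phi>'\<bar>\<close> times the L1 distance, so L1 convergence carries the bound M
  over to u.\<close>

lemma integral_mult_deriv_le_if_L1_limit:
  fixes w h :: "nat \<Rightarrow> real \<Rightarrow> real" and u \<phi> \<phi>' :: "real \<Rightarrow> real"
  assumes ab: "a \<le> b"
    and h: "\<And>j. h j absolutely_integrable_on {a..b}"
    and inc: "\<And>j x y. a \<le> x \<Longrightarrow> x \<le> y \<Longrightarrow> y \<le> b \<Longrightarrow> integral {x..y} (h j) = w j y - w j x"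
    and cw: "\<And>j. continuous_on {a..b} (w j)" and per: "\<And>j. w j a = w j b"
    and M: "\<And>j. integral {a..b} (\<lambda>t. \<bar>h j t\<bar>) \<le> M"
    and u: "u absolutely_integrable_on {a..b}"
    and lim: "(\<lambda>j. integral {a..b} (\<lambda>t. \<bar>w j t - u t\<bar>)) \<longlonglongrightarrow> 0"
    and \<phi>: "\<And>s. (\<phi> has_real_derivative \<phi>' s) (at s)" and c\<phi>': "continuous_on UNIV \<phi>'"
    and \<phi>1: "\<And>s. \<bar>\<phi> s\<bar> \<le> 1" and \<phi>ab: "\<phi> a = \<phi> b"
  shows "integral {a..b} (\<lambda>t. u t * \<phi>' t) \<le> M"
proof -
  have c: "continuous_on {a..b} \<phi>'" using c\<phi>' continuous_on_subset by blast
  have c\<phi>: "continuous_on {a..b} \<phi>"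
    using \<phi> by (meson DERIV_continuous_on DERIV_subset top_greatest)
  obtain B where B: "\<And>t. t \<in> {a..b} \<Longrightarrow> \<bar>\<phi>' t\<bar> \<le> B"
    using compact_imp_bounded[OF compact_continuous_image[OF c compact_Icc]] unfolding bounded_iff by fastforce
  have wj: "integral {a..b} (\<lambda>t. w j t * \<phi>' t) \<le> M" for j
  proof -
    have i: "(\<lambda>t. h j t * \<phi> t) absolutely_integrable_on {a..b}"
      using absolutely_integrable_continuous_mult[OF c\<phi> h] by (simp add: mult.commute)
    have "integral {a..b} (\<lambda>t. w j t * \<phi>' t) = - integral {a..b} (\<lambda>t. h j t * \<phi> t)"
      using absolutely_continuous_by_parts[OF ab h inc cw \<phi> c\<phi>'] per \<phi>ab by simp
    also have "\<dots> \<le> norm (integral {a..b} (\<lambda>t. h j t * \<phi> t))" by simp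
    also have "\<dots> \<le> integral {a..b} (\<lambda>t. \<bar>h j t\<bar>)"
    proof (rule integral_norm_bound_integral)
      show "norm (h j t * \<phi> t) \<le> \<bar>h j t\<bar>" for t
        using mult_left_mono[OF \<phi>1[of t], of "\<bar>h j t\<bar>"] by (simp add: abs_mult)
    qed (use i h[of j] in \<open>auto simp: absolutely_integrable_on_def\<close>)
    finally show ?thesis using M[of j] by linarith
  qed
  have awu: "(\<lambda>t. w j t - u t) absolutely_integrable_on {a..b}" for j
    by (rule set_integral_diff(1)[OF absolutely_integrable_continuous_real[OF cw] u])
  have bound: "integral {a..b} (\<lambda>t. u t * \<phi>' t) \<le> M + B * integral {a..b} (\<lambda>t. \<bar>w j t - u t\<bar>)" for j
  proof -
    have i1: "(\<lambda>t. u t * \<phi>' t) integrable_on {a..b}"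
      using absolutely_integrable_continuous_mult[OF c u] by (simp add: mult.commute absolutely_integrable_on_def)
    have i2: "(\<lambda>t. w j t * \<phi>' t) integrable_on {a..b}"
      using absolutely_integrable_continuous_mult[OF c absolutely_integrable_continuous_real[OF cw]]
      by (simp add: mult.commute absolutely_integrable_on_def)
    have "integral {a..b} (\<lambda>t. u t * \<phi>' t) - integral {a..b} (\<lambda>t. w j t * \<phi>' t) = integral {a..b} (\<lambda>t. u t * \<phi>' t - w j t * \<phi>' t)"
      by (rule Henstock_Kurzweil_Integration.integral_diff[OF i1 i2, symmetric])
    also have "\<dots> \<le> norm \<dots>" by simp
    also have "\<dots> \<le> integral {a..b} (\<lambda>t. B * \<bar>w j t - u t\<bar>)"
    proof (rule integral_norm_bound_integral)
      fix t assume "t \<in> {a..b}"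
      from mult_right_mono[OF B[OF this], of "\<bar>w j t - u t\<bar>"]
      moreover have "u t * \<phi>' t - w j t * \<phi>' t = \<phi>' t * (u t - w j t)" by (simp add: algebra_simps)
      ultimately show "norm (u t * \<phi>' t - w j t * \<phi>' t) \<le> B * \<bar>w j t - u t\<bar>"
        by (simp only: real_norm_def abs_mult abs_minus_commute)
    next
      show "(\<lambda>t. u t * \<phi>' t - w j t * \<phi>' t) integrable_on {a..b}" by (rule integrable_diff[OF i1 i2])
      show "(\<lambda>t. B * \<bar>w j t - u t\<bar>) integrable_on {a..b}"
        using awu[of j] by (intro integrable_on_mult_right) (simp add: absolutely_integrable_on_def)
    qed
    finally show ?thesis using wj[of j] by simp
  qed
  have "(\<lambda>j. M + B * integral {a..b} (\<lambda>t. \<bar>w j t - u t\<bar>)) \<longlonglongrightarrow> M + B * 0"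
    by (intro tendsto_intros lim)
  from tendsto_lowerbound[OF this, of "integral {a..b} (\<lambda>t. u t * \<phi>' t)"] bound show ?thesis by simp
qed

text \<open>Otherwise points of \<open>E\<close> where \<open>u\<close> alternates between the two values accumulate at \<open>b\<close>,
  and finitely many of them already force \<open>w j\<close> to vary by more than \<open>M\<close>.\<close>

lemma two_valued_limit_eventually_constant_right:
  fixes w m :: "nat \<Rightarrow> real \<Rightarrow> real" and u :: "real \<Rightarrow> real"
  assumes E: "E \<subseteq> {..<b}"
    and var: "\<And>j x y. x \<in> E \<Longrightarrow> y \<in> E \<Longrightarrow> x \<le> y \<Longrightarrow> \<bar>w j y - w j x\<bar> \<le> m j y - m j x"
    and M: "\<And>j x y. x \<in> E \<Longrightarrow> y \<in> E \<Longrightarrow> m j y - m j x \<le> M"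
    and lim: "\<And>x. x \<in> E \<Longrightarrow> (\<lambda>j. w j x) \<longlonglongrightarrow> u x"
    and val: "\<And>x. x \<in> E \<Longrightarrow> u x \<in> {p, q}"
  shows "\<exists>k. \<exists>c<b. \<forall>x\<in>E. c < x \<longrightarrow> u x = k"
proof (rule ccontr)
  assume "\<not> ?thesis"
  then have next_point: "\<exists>x\<in>E. c < x \<and> u x \<noteq> k" if "c < b" for k c using that by blast
  have "\<exists>x. \<forall>n. x n \<in> E \<and> (x n < x (Suc n) \<and> u (x (Suc n)) \<noteq> u (x n))"
  proof (rule dependent_nat_choice)
    show "\<exists>x. x \<in> E" using next_point[of "b - 1"] by auto
    show "\<exists>y. y \<in> E \<and> x < y \<and> u y \<noteq> u x" if "x \<in> E" for x n
      using next_point[of x "u x"] that E by auto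
  qed
  then obtain x where xE: "\<And>n. x n \<in> E" and x_inc: "\<And>n. x n < x (Suc n)" and u_ne: "\<And>n. u (x (Suc n)) \<noteq> u (x n)"
    by blast
  \<comment> \<open>With only two values available, every change of value has the same size, so N
    changes cost N times that amount.\<close>
  have jump: "\<bar>u (x (Suc n)) - u (x n)\<bar> = \<bar>p - q\<bar>" for n
    using val[OF xE[of n]] val[OF xE[of "Suc n"]] u_ne[of n] by (auto simp: abs_minus_commute)
  have pq: "p \<noteq> q"
    using val[OF xE[of 0]] val[OF xE[of "Suc 0"]] u_ne[of 0] by auto
  have "real N * \<bar>p - q\<bar> \<le> M" for N
  proof -
    have "(\<Sum>n<N. \<bar>w j (x (Suc n)) - w j (x n)\<bar>) \<le> M" for j
    proof -
      have "(\<Sum>n<N. \<bar>w j (x (Suc n)) - w j (x n)\<bar>) \<le> (\<Sum>n<N. m j (x (Suc n)) - m j (x n))"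
        by (intro sum_mono var xE less_imp_le[OF x_inc])
      also have "\<dots> = m j (x N) - m j (x 0)" by (rule sum_lessThan_telescope)
      also have "\<dots> \<le> M" by (intro M xE)
      finally show ?thesis .
    qed
    moreover have "(\<lambda>j. \<Sum>n<N. \<bar>w j (x (Suc n)) - w j (x n)\<bar>) \<longlonglongrightarrow> (\<Sum>n<N. \<bar>u (x (Suc n)) - u (x n)\<bar>)"
      by (intro tendsto_intros lim xE)
    ultimately have "(\<Sum>n<N. \<bar>u (x (Suc n)) - u (x n)\<bar>) \<le> M"
      by (intro tendsto_upperbound) auto
    then show ?thesis by (simp add: jump)
  qed
  moreover obtain N where "M < real N * \<bar>p - q\<bar>"
    using reals_Archimedean3[of "\<bar>p - q\<bar>"] pq by auto
  ultimately show False by (metis not_less)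
qed

text \<open>Reflection reduces this to the right end. The variation function becomes
  \<open>- m j (- x)\<close>, with a sign so that its increments are again nonnegative upper
  bounds.\<close>

lemma two_valued_limit_eventually_constant_left:
  fixes w m :: "nat \<Rightarrow> real \<Rightarrow> real" and u :: "real \<Rightarrow> real"
  assumes E: "E \<subseteq> {a<..}"
    and var: "\<And>j x y. x \<in> E \<Longrightarrow> y \<in> E \<Longrightarrow> x \<le> y \<Longrightarrow> \<bar>w j y - w j x\<bar> \<le> m j y - m j x"
    and M: "\<And>j x y. x \<in> E \<Longrightarrow> y \<in> E \<Longrightarrow> m j y - m j x \<le> M"
    and lim: "\<And>x. x \<in> E \<Longrightarrow> (\<lambda>j. w j x) \<longlonglongrightarrow> u x"
    and val: "\<And>x. x \<in> E \<Longrightarrow> u x \<in> {p, q}"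
  shows "\<exists>k. \<exists>c>a. \<forall>x\<in>E. x < c \<longrightarrow> u x = k"
proof -
  have "\<exists>k. \<exists>c< - a. \<forall>x\<in>uminus ` E. c < x \<longrightarrow> u (- x) = k"
  proof (rule two_valued_limit_eventually_constant_right)
    show "uminus ` E \<subseteq> {..< - a}" using E by auto
    show "\<bar>w j (- y) - w j (- x)\<bar> \<le> - m j (- y) - - m j (- x)" if "x \<in> uminus ` E" "y \<in> uminus ` E" "x \<le> y" for j x y
      using var[of "- y" "- x" j] that by (auto simp: abs_minus_commute)
    show "- m j (- y) - - m j (- x) \<le> M" if "x \<in> uminus ` E" "y \<in> uminus ` E" for j x y
      using M[of "- y" "- x" j] that by auto
    show "(\<lambda>j. w j (- x)) \<longlonglongrightarrow> u (- x)" "u (- x) \<in> {p, q}" if "x \<in> uminus ` E" for x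
      using lim[of "- x"] val[of "- x"] that by auto
  qed
  then obtain k c where c: "c < - a" "\<And>x. x \<in> E \<Longrightarrow> c < - x \<Longrightarrow> u x = k" by auto
  then show ?thesis by (intro exI[of _ k] exI[of _ "- c"]) auto
qed

section \<open>Recovering the jump between the identified end points\<close>

text \<open>The kernel has unit mass on the interval from p to q and vanishes elsewhere, so it reads
  off the constant value that u has there.\<close>

lemma integral_mult_step_deriv:
  fixes u :: "real \<Rightarrow> real"
  assumes ab: "a \<le> p" "p < q" "q \<le> b" and u: "AE x in lebesgue_on {p<..<q}. u x = k"
  shows "((\<lambda>t. u t * (tent ((t - p) / (q - p)) / (q - p))) has_integral k) {a..b}"
proof -
  let ?K = "\<lambda>t. tent ((t - p) / (q - p)) / (q - p)"
  have "(?K has_integral ramp ((b - p) / (q - p)) - ramp ((a - p) / (q - p))) {a..b}"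
    using ab ramp_scaled_deriv[of p "q - p"]
    by (intro fundamental_theorem_of_calculus)
      (auto simp: has_real_derivative_iff_has_vector_derivative[symmetric] intro: DERIV_subset)
  moreover have "ramp ((b - p) / (q - p)) = 1" using ab by (intro ramp_eq_1) (auto simp: field_simps)
  moreover have "ramp ((a - p) / (q - p)) = 0" using ab by (intro ramp_eq_0) (auto simp: divide_le_0_iff)
  ultimately have K: "((\<lambda>t. k * ?K t) has_integral k) {a..b}"
    using has_integral_mult_right[of ?K 1 "{a..b}" k] by simp
  obtain N where N: "negligible N" "\<And>x. x \<in> {p<..<q} \<Longrightarrow> x \<notin> N \<Longrightarrow> u x = k"
    using AE_lebesgue_onE[OF u] by auto
  have "u t * ?K t = k * ?K t" if "t \<notin> N" for t
  proof (cases "t \<in> {p<..<q}")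
    case False
    then have "?K t = 0" using ab by (subst tent_eq_0) (auto simp: field_simps)
    then show ?thesis by (simp only: mult_zero_right)
  qed (use N(2)[of t] that in simp)
  then show ?thesis by (intro has_integral_spike[OF N(1) _ K]) auto
qed

text \<open>The jump across the identified end points is picked up by adding to a compactly supported
  test function a cutoff that is \<open>1\<close> at \<open>a\<close> and \<open>b\<close> and lives where \<open>u\<close> is constant.\<close>

lemma total_variation_plus_boundary_jump_le:
  fixes u :: "real \<Rightarrow> real"
  assumes u: "u absolutely_integrable_on {a..b}"
    and test: "\<And>\<phi> \<phi>' :: real \<Rightarrow> real. (\<And>s. (\<phi> has_real_derivative \<phi>' s) (at s)) \<Longrightarrow> continuous_on UNIV \<phi>' \<Longrightarrow>
      (\<And>s. \<bar>\<phi> s\<bar> \<le> 1) \<Longrightarrow> \<phi> a = \<phi> b \<Longrightarrow> integral {a..b} (\<lambda>t. u t * \<phi>' t) \<le> M"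
    and right: "c < b" "AE x in lebesgue_on {c<..<b}. u x = k1"
    and left: "a < d" "AE x in lebesgue_on {a<..<d}. u x = k0"
    and ab: "a < b"
  shows "total_variation {a<..<b} u + ennreal \<bar>k1 - k0\<bar> \<le> ennreal M"
proof -
  have main: "(\<integral>x. u x * deriv \<phi> x \<partial>lebesgue_on {a<..<b}) \<le> M - \<bar>k1 - k0\<bar>"
    if \<phi>: "\<phi> \<in> C1c {a<..<b}" and \<phi>1: "\<And>x. \<bar>\<phi> x\<bar> \<le> 1" for \<phi>
  proof -
    obtain c' d' where cd: "a < c'" "c' < d'" "d' < b" and z: "\<And>x. x \<notin> {c'<..<d'} \<Longrightarrow> \<phi> x = 0 \<and> deriv \<phi> x = 0"
      using C1c_Ioo_support[OF \<phi> ab] by blast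
    have C1: "\<phi> C1_differentiable_on UNIV" using \<phi> by (auto simp: C1c_def)
    note D = C1_differentiable_on_UNIV_D[OF C1]
    \<comment> \<open>Left of q and right of p the function u is constant and \<phi> vanishes, so a
      cutoff living there interferes with neither.\<close>
    define p q where "p = max c d'" and "q = min d c'"
    have pq: "a < q" "q < p" "p < b" using cd right left by (auto simp: p_def q_def)
    \<comment> \<open>The cutoff descends from 1 to 0 between a and q and climbs back to 1 between p
      and b. The climb will contribute \<open>k1\<close> and the descent
      \<open>- k0\<close>.\<close>
    define \<eta> where "\<eta> = (\<lambda>t. ramp ((t - p) / (b - p)) + 1 - ramp ((t - a) / (q - a)))"
    define \<eta>' where "\<eta>' = (\<lambda>t. tent ((t - p) / (b - p)) / (b - p) - tent ((t - a) / (q - a)) / (q - a))"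
    have \<eta>: "(\<eta> has_real_derivative \<eta>' t) (at t)" for t
      unfolding \<eta>_def \<eta>'_def by (rule derivative_eq_intros ramp_scaled_deriv refl | simp)+
    have c\<eta>': "continuous_on UNIV \<eta>'"
      unfolding \<eta>'_def using pq by (intro continuous_intros) auto
    have \<eta>_mid: "\<eta> t = 0" if "t \<in> {q..p}" for t
    proof -
      have "(t - p) / (b - p) \<le> 0" "(t - a) / (q - a) \<ge> 1" using that pq by (auto simp: field_simps divide_le_0_iff)
      then show ?thesis by (simp add: \<eta>_def ramp_eq_0 ramp_eq_1)
    qed
    have \<eta>_bd: "0 \<le> \<eta> t \<and> \<eta> t \<le> 1" for t
    proof (cases "t \<le> p")
      case True
      then have "(t - p) / (b - p) \<le> 0" using pq by (auto simp: divide_le_0_iff)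
      then show ?thesis using ramp_bounds[of "(t - a) / (q - a)"] by (simp add: \<eta>_def ramp_eq_0)
    next
      case False
      then have "(t - a) / (q - a) \<ge> 1" using pq by (auto simp: field_simps)
      then show ?thesis using ramp_bounds[of "(t - p) / (b - p)"] by (simp add: \<eta>_def ramp_eq_1)
    qed
    have \<eta>_end: "\<eta> a = 1" "\<eta> b = 1"
    proof -
      have "(a - p) / (b - p) \<le> 0" "(b - a) / (q - a) \<ge> 1" using pq by (auto simp: field_simps divide_le_0_iff)
      then show "\<eta> a = 1" "\<eta> b = 1" using pq by (simp_all add: \<eta>_def ramp_eq_0 ramp_eq_1)
    qed
    have int\<eta>: "((\<lambda>t. u t * \<eta>' t) has_integral k1 - k0) {a..b}"
    proof -
      have "AE x in lebesgue_on {p<..<b}. u x = k1"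
        using right(2) by (auto simp: AE_restrict_space_iff p_def elim: eventually_mono)
      moreover have "AE x in lebesgue_on {a<..<q}. u x = k0"
        using left(2) by (auto simp: AE_restrict_space_iff q_def elim: eventually_mono)
      ultimately show ?thesis
        unfolding \<eta>'_def right_diff_distrib using pq
        by (intro has_integral_diff integral_mult_step_deriv) auto
    qed
    have c\<phi>': "continuous_on {a..b} (deriv \<phi>)" using D(2) continuous_on_subset by blast
    have iu\<phi>: "(\<lambda>t. u t * deriv \<phi> t) absolutely_integrable_on {a..b}"
      using absolutely_integrable_continuous_mult[OF c\<phi>' u] by (simp add: mult.commute)
    have eq: "(\<integral>x. u x * deriv \<phi> x \<partial>lebesgue_on {a<..<b}) = integral {a..b} (\<lambda>t. u t * deriv \<phi> t)"
      by (rule integral_lebesgue_on_Ioo[OF iu\<phi>])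
    \<comment> \<open>The two signs of s together produce the absolute value of the jump. The sum
      stays bounded by 1 since at every point \<phi> or \<eta> is zero.\<close>
    have "integral {a..b} (\<lambda>t. u t * deriv \<phi> t) + s * (k1 - k0) \<le> M" if s: "\<bar>s\<bar> = 1" for s
    proof -
      have "integral {a..b} (\<lambda>t. u t * (deriv \<phi> t + s * \<eta>' t)) \<le> M"
      proof (rule test)
        show "((\<lambda>t. \<phi> t + s * \<eta> t) has_real_derivative deriv \<phi> t + s * \<eta>' t) (at t)" for t
          by (intro DERIV_add DERIV_cmult D(1) \<eta>)
        show "continuous_on UNIV (\<lambda>t. deriv \<phi> t + s * \<eta>' t)"
          by (intro continuous_intros D(2) c\<eta>')
        show "\<phi> a + s * \<eta> a = \<phi> b + s * \<eta> b" using z[of a] z[of b] cd \<eta>_end by simp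
        show "\<bar>\<phi> t + s * \<eta> t\<bar> \<le> 1" for t
        proof (cases "t \<in> {q..p}")
          case True
          then show ?thesis using \<phi>1[of t] \<eta>_mid by simp
        next
          case False
          then have "t \<notin> {c'<..<d'}" by (auto simp: p_def q_def)
          then have "\<phi> t = 0" using z by blast
          then show ?thesis using \<eta>_bd[of t] s by (simp add: abs_mult)
        qed
      qed
      also have "(\<lambda>t. u t * (deriv \<phi> t + s * \<eta>' t)) = (\<lambda>t. u t * deriv \<phi> t + s * (u t * \<eta>' t))"
        by (simp add: algebra_simps)
      also have "integral {a..b} \<dots> = integral {a..b} (\<lambda>t. u t * deriv \<phi> t) + s * (k1 - k0)"
        using iu\<phi> by (intro integral_unique has_integral_add has_integral_mult_right int\<eta> integrable_integral)
          (auto simp: absolutely_integrable_on_def)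
      finally show ?thesis .
    qed
    from this[of 1] this[of "-1"] show ?thesis unfolding eq by (simp add: abs_if)
  qed
  \<comment> \<open>Testing with 0 shows that \<open>M - \<bar>k1 - k0\<bar>\<close> is nonnegative,
    so \<open>ennreal\<close> does not truncate it and the jump can be added back.\<close>
  have "(\<lambda>_. 0) \<in> C1c {a<..<b}"
    by (rule C1c_Ioo_I[where \<phi>' = "\<lambda>_. 0" and c = "(2 * a + b) / 3" and d = "(a + 2 * b) / 3"]) (use ab in auto)
  from main[OF this] have M: "\<bar>k1 - k0\<bar> \<le> M" by simp
  have "total_variation {a<..<b} u \<le> ennreal (M - \<bar>k1 - k0\<bar>)"
    unfolding total_variation_def using main by (intro SUP_least ennreal_leI) auto
  then have "total_variation {a<..<b} u + ennreal \<bar>k1 - k0\<bar> \<le> ennreal (M - \<bar>k1 - k0\<bar>) + ennreal \<bar>k1 - k0\<bar>"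
    by (rule add_right_mono)
  also have "\<dots> = ennreal M" using M by (simp flip: ennreal_plus)
  finally show ?thesis .
qed

section \<open>Traces of functions that are constant near an end point\<close>

text \<open>For small r the average equals \<open>\<bar>k - c\<bar>\<close> exactly, so existence
  and uniqueness of the trace come together, as \<open>THE\<close> requires. The moving left end
  \<open>s r\<close> serves both sides: \<open>b - r\<close> for left traces, the constant a for
  right ones.\<close>

lemma has_trace_const_iff:
  fixes u :: "real \<Rightarrow> real"
  assumes "\<delta> > 0" and "\<And>r. r > 0 \<Longrightarrow> r < \<delta> \<Longrightarrow> AE x in lebesgue_on {s r<..<s r + r}. u x = k"
  shows "((\<lambda>r. (\<integral>x. \<bar>u x - c\<bar> \<partial>lebesgue_on {s r<..<s r + r}) / r) \<longlongrightarrow> 0) (at_right 0) \<longleftrightarrow> c = k"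
proof -
  have "\<forall>\<^sub>F r in at_right 0. (\<integral>x. \<bar>u x - c\<bar> \<partial>lebesgue_on {s r<..<s r + r}) / r = \<bar>k - c\<bar>"
    unfolding eventually_at_right_field
  proof (intro exI[of _ \<delta>] conjI allI impI)
    fix r assume r: "0 < r" "r < \<delta>"
    obtain N where N: "negligible N" "\<And>x. x \<in> {s r<..<s r + r} \<Longrightarrow> x \<notin> N \<Longrightarrow> u x = k"
      using AE_lebesgue_onE[OF assms(2)[OF r]] by auto
    have k: "((\<lambda>x. \<bar>k - c\<bar>) has_integral (r * \<bar>k - c\<bar>)) {s r..s r + r}"
      using has_integral_const_real[of "\<bar>k - c\<bar>" "s r" "s r + r"] r by simp
    have neg: "negligible (N \<union> {s r, s r + r})" using N(1) by (intro negligible_Un) auto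
    have "\<bar>u x - c\<bar> = \<bar>k - c\<bar>" if "x \<in> {s r..s r + r} - (N \<union> {s r, s r + r})" for x
      using N(2)[of x] that by auto
    from has_integral_spike[OF neg this k] have i: "((\<lambda>x. \<bar>u x - c\<bar>) has_integral (r * \<bar>k - c\<bar>)) {s r..s r + r}" .
    then have "(\<lambda>x. \<bar>u x - c\<bar>) absolutely_integrable_on {s r..s r + r}"
      by (intro nonnegative_absolutely_integrable_1) (auto simp: has_integral_integrable)
    from integral_lebesgue_on_Ioo[OF this] i
    show "(\<integral>x. \<bar>u x - c\<bar> \<partial>lebesgue_on {s r<..<s r + r}) / r = \<bar>k - c\<bar>"
      using r by (simp add: integral_unique)
  qed (rule assms)
  from tendsto_cong[OF this] show ?thesis by (auto simp: tendsto_const_iff)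
qed

lemma trace_left_eqI:
  assumes "c < b" "AE x in lebesgue_on {c<..<b}. u x = k"
  shows "trace_left u b = k"
proof -
  have "AE x in lebesgue_on {b - r<..<b - r + r}. u x = k" if "r > 0" "r < b - c" for r
    using assms(2) that by (auto simp: AE_restrict_space_iff elim!: eventually_mono)
  from has_trace_const_iff[where \<delta> = "b - c" and s = "\<lambda>r. b - r", OF _ this] show ?thesis
    using assms(1) by (auto simp: trace_left_def)
qed

lemma trace_right_eqI:
  assumes "a < c" "AE x in lebesgue_on {a<..<c}. u x = k"
  shows "trace_right u a = k"
proof -
  have "AE x in lebesgue_on {a<..<a + r}. u x = k" if "r > 0" "r < c - a" for r
    using assms(2) that by (auto simp: AE_restrict_space_iff elim!: eventually_mono)
  from has_trace_const_iff[where \<delta> = "c - a" and s = "\<lambda>_. a", OF _ this] show ?thesis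
    using assms(1) by (auto simp: trace_right_def)
qed

section \<open>The transition energy\<close>

lemma continuous_on_W [continuous_intros]:
  fixes f :: "real \<Rightarrow> real"
  assumes "continuous_on A f"
  shows "continuous_on A (\<lambda>t. W \<sigma> D2 (f t))"
  unfolding W_def W_raw_def by (intro continuous_intros assms) auto

lemma Phi_deriv: "(Phi \<sigma> D2 has_real_derivative 2 * sqrt (W \<sigma> D2 s)) (at s)"
proof -
  \<comment> \<open>The margin 1 makes s an interior point, so that the one-sided derivative is a
    full one on either side of the lower limit of integration.\<close>
  define a b where "a = min (- well \<sigma> D2) s - 1" and "b = max (- well \<sigma> D2) s + 1"
  have "((\<lambda>u. LBINT t=ereal (- well \<sigma> D2)..ereal u. sqrt (W \<sigma> D2 t)) has_vector_derivative sqrt (W \<sigma> D2 s)) (at s within {a..b})"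
    by (rule interval_integral_FTC2) (auto simp: a_def b_def intro!: continuous_intros)
  then have "((\<lambda>u. LBINT t=ereal (- well \<sigma> D2)..ereal u. sqrt (W \<sigma> D2 t)) has_real_derivative sqrt (W \<sigma> D2 s)) (at s within {a..b})"
    by (simp add: has_real_derivative_iff_has_vector_derivative)
  also have "at s within {a..b} = at s"
    by (rule at_within_Icc_at) (auto simp: a_def b_def)
  finally show ?thesis unfolding Phi_def[abs_def] by (rule DERIV_cmult)
qed

lemma W_bounded: "\<exists>K. \<forall>s. W \<sigma> D2 s \<le> K"
proof (intro exI allI)
  fix s :: real
  have p: "\<bar>sin (s/2) ^ n\<bar> \<le> 1" for n by (simp add: power_abs power_le_one)
  have "c * sin (s/2) ^ n \<le> \<bar>c\<bar>" for c n
    using mult_left_mono[OF p[of n], of "\<bar>c\<bar>"] by (simp add: abs_mult[symmetric])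
  from this[of "8 * D2" 8] this[of "4 * (1 + \<sigma>)" 4] this[of "- (4 * \<sigma>)" 2]
  show "W \<sigma> D2 s \<le> \<bar>8 * D2\<bar> + \<bar>4 * (1 + \<sigma>)\<bar> + \<bar>4 * \<sigma>\<bar> + a0 \<sigma> D2"
    unfolding W_def W_raw_def by simp
qed

lemma Phi_Lipschitz:
  assumes "\<sigma> > 0" "D2 > 0"
  shows "\<exists>K\<ge>0. \<forall>x y. \<bar>Phi \<sigma> D2 x - Phi \<sigma> D2 y\<bar> \<le> K * \<bar>x - y\<bar>"
proof -
  obtain K where K: "\<And>s. W \<sigma> D2 s \<le> K" using W_bounded by blast
  have K0: "0 \<le> K" using W_wells(1)[OF assms, of 0] K[of 0] by linarith
  have "\<bar>Phi \<sigma> D2 x - Phi \<sigma> D2 y\<bar> \<le> 2 * sqrt K * \<bar>x - y\<bar>" for x y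
    using field_differentiable_bound[of UNIV "Phi \<sigma> D2" "\<lambda>s. 2 * sqrt (W \<sigma> D2 s)" "2 * sqrt K" x y]
      Phi_deriv[of \<sigma> D2] K W_wells(1)[OF assms] by (simp add: abs_mult)
  then show ?thesis using K0 by (intro exI[of _ "2 * sqrt K"]) auto
qed

lemma Phi_minus_well: "Phi \<sigma> D2 (- well \<sigma> D2) = 0"
  by (simp add: Phi_def)

text \<open>Strictly between the wells \<open>W\<close> is positive, so \<open>Phi\<close> increases
  strictly there. This makes \<open>Phi\<close> separate the wells: its value tells which one is
  occupied.\<close>

lemma Phi_well_pos:
  assumes "\<sigma> > 0" "D2 > 0"
  shows "Phi \<sigma> D2 (well \<sigma> D2) > 0"
proof -
  note w = W_wells[OF assms]
  have "Phi \<sigma> D2 (- well \<sigma> D2) < Phi \<sigma> D2 (well \<sigma> D2)"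
  proof (rule DERIV_pos_imp_increasing_open[where f = "Phi \<sigma> D2"])
    show "- well \<sigma> D2 < well \<sigma> D2" using w(2) by simp
    show "continuous_on {- well \<sigma> D2..well \<sigma> D2} (Phi \<sigma> D2)"
      using Phi_deriv by (meson DERIV_continuous_on DERIV_subset top_greatest)
    fix x assume x: "- well \<sigma> D2 < x" "x < well \<sigma> D2"
    have "x \<in> {-pi..pi}" using x w(2) pi_gt_zero by auto
    moreover have "x \<notin> {- well \<sigma> D2, well \<sigma> D2}" using x by auto
    ultimately have "W \<sigma> D2 x \<noteq> 0" using w(2) by blast
    then have "0 < sqrt (W \<sigma> D2 x)" using w(1)[of x] by simp
    then show "\<exists>y. (Phi \<sigma> D2 has_real_derivative y) (at x) \<and> 0 < y"
      using Phi_deriv[of \<sigma> D2 x] by auto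
  qed
  then show ?thesis by (simp add: Phi_minus_well)
qed

section \<open>Square integrable functions\<close>

lemma finite_measure_lebesgue_on_Ioo: "finite_measure (lebesgue_on {a<..<b::real})"
  by (rule finite_measure_lebesgue_on) auto

lemma L2_on_diff:
  assumes "u \<in> L2_on S" "v \<in> L2_on S"
  shows "(\<lambda>x. u x - v x) \<in> L2_on S"
proof -
  have [measurable]: "u \<in> borel_measurable (lebesgue_on S)" "v \<in> borel_measurable (lebesgue_on S)"
    using assms by (auto simp: L2_on_def)
  have "integrable (lebesgue_on S) (\<lambda>x. (u x - v x)\<^sup>2)"
  proof (rule Bochner_Integration.integrable_bound)
    show "integrable (lebesgue_on S) (\<lambda>x. 2 * (u x)\<^sup>2 + 2 * (v x)\<^sup>2)" using assms by (auto simp: L2_on_def)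
    have "(u x - v x)\<^sup>2 \<le> 2 * (u x)\<^sup>2 + 2 * (v x)\<^sup>2" for x
      using zero_le_power2[of "u x + v x"] by (simp add: power2_eq_square algebra_simps)
    then show "AE x in lebesgue_on S. norm ((u x - v x)\<^sup>2) \<le> norm (2 * (u x)\<^sup>2 + 2 * (v x)\<^sup>2)" by simp
  qed measurable
  then show ?thesis by (simp add: L2_on_def)
qed

lemma L2_on_uminus: "u \<in> L2_on S \<Longrightarrow> (\<lambda>x. - u x) \<in> L2_on S"
  by (auto simp: L2_on_def)

lemma L2_on_Ioo_integrable:
  assumes "u \<in> L2_on {a<..<b}"
  shows "integrable (lebesgue_on {a<..<b}) u"
proof -
  interpret finite_measure "lebesgue_on {a<..<b}" by (rule finite_measure_lebesgue_on_Ioo)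
  show ?thesis
  proof (rule Bochner_Integration.integrable_bound)
    show "integrable (lebesgue_on {a<..<b}) (\<lambda>x. 1 + (u x)\<^sup>2)" using assms by (auto simp: L2_on_def)
    have "\<bar>u x\<bar> \<le> 1 + (u x)\<^sup>2" for x
      using zero_le_power2[of "\<bar>u x\<bar> - 1"] by (simp add: power2_eq_square algebra_simps)
    then show "AE x in lebesgue_on {a<..<b}. norm (u x) \<le> norm (1 + (u x)\<^sup>2)" by simp
  qed (use assms in \<open>auto simp: L2_on_def\<close>)
qed

lemma bounded_measurable_in_L2_on_Ioo:
  assumes "u \<in> borel_measurable (lebesgue_on {a<..<b})" "\<And>x. \<bar>u x\<bar> \<le> B"
  shows "u \<in> L2_on {a<..<b}"
proof -
  interpret finite_measure "lebesgue_on {a<..<b}" by (rule finite_measure_lebesgue_on_Ioo)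
  have "\<bar>(u x)\<^sup>2\<bar> \<le> B\<^sup>2" for x
    using power_mono[OF assms(2)[of x], of 2] by simp
  then show ?thesis using assms(1) by (auto simp: L2_on_def intro!: integrable_const_bound[of _ "B\<^sup>2"])
qed

text \<open>Cauchy-Schwarz against the constant 1, obtained by expanding the square of
  \<open>\<bar>u x\<bar> - m\<close> with m the mean of |u|.\<close>

lemma L1_le_L2:
  assumes "u \<in> L2_on {a<..<b}" "a < b"
  shows "(\<integral>x. \<bar>u x\<bar> \<partial>lebesgue_on {a<..<b}) \<le> sqrt ((b - a) * (\<integral>x. (u x)\<^sup>2 \<partial>lebesgue_on {a<..<b}))"
proof -
  interpret finite_measure "lebesgue_on {a<..<b}" by (rule finite_measure_lebesgue_on_Ioo)
  define s where "s = (\<integral>x. \<bar>u x\<bar> \<partial>lebesgue_on {a<..<b})"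
  define m where "m = s / (b - a)"
  have i: "integrable (lebesgue_on {a<..<b}) (\<lambda>x. \<bar>u x\<bar>)" "integrable (lebesgue_on {a<..<b}) (\<lambda>x. (u x)\<^sup>2)"
    using L2_on_Ioo_integrable[OF assms(1)] assms(1) by (auto simp: L2_on_def)
  have meas: "measure (lebesgue_on {a<..<b}) {a<..<b} = b - a"
    using assms(2) by (simp add: measure_restrict_space)
  have "0 \<le> (\<integral>x. (\<bar>u x\<bar> - m)\<^sup>2 \<partial>lebesgue_on {a<..<b})" by simp
  also have "(\<lambda>x. (\<bar>u x\<bar> - m)\<^sup>2) = (\<lambda>x. (u x)\<^sup>2 - 2 * m * \<bar>u x\<bar> + m\<^sup>2)"
    by (simp add: power2_eq_square algebra_simps)
  also have "(\<integral>x. (u x)\<^sup>2 - 2 * m * \<bar>u x\<bar> + m\<^sup>2 \<partial>lebesgue_on {a<..<b}) =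
      (\<integral>x. (u x)\<^sup>2 \<partial>lebesgue_on {a<..<b}) - 2 * m * s + m\<^sup>2 * (b - a)"
    using i by (simp add: s_def meas)
  finally have "0 \<le> (b - a) * ((\<integral>x. (u x)\<^sup>2 \<partial>lebesgue_on {a<..<b}) - 2 * m * s + m\<^sup>2 * (b - a))"
    using assms(2) by simp
  moreover have ms: "m * (b - a) = s" using assms(2) by (simp add: m_def)
  have "(b - a) * (J - 2 * m * s + m\<^sup>2 * (b - a)) = (b - a) * J - 2 * (m * (b - a)) * s + (m * (b - a))\<^sup>2" for J
    by (simp add: power2_eq_square algebra_simps)
  then have "(b - a) * (J - 2 * m * s + m\<^sup>2 * (b - a)) = (b - a) * J - s\<^sup>2" for J
    unfolding ms by (simp add: power2_eq_square)
  ultimately have "s\<^sup>2 \<le> (b - a) * (\<integral>x. (u x)\<^sup>2 \<partial>lebesgue_on {a<..<b})" by simp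
  then show ?thesis unfolding s_def[symmetric] by (rule real_le_rsqrt)
qed

section \<open>L1 limits in integrals and in weak derivatives\<close>

lemma tendsto_integral_mult_if_L1:
  fixes f :: "nat \<Rightarrow> real \<Rightarrow> real" and u \<psi> :: "real \<Rightarrow> real"
  assumes f: "\<And>j. integrable M (f j)" and u: "integrable M u"
    and lim: "(\<lambda>j. \<integral>x. \<bar>f j x - u x\<bar> \<partial>M) \<longlonglongrightarrow> 0"
    and \<psi>: "\<psi> \<in> borel_measurable M" "\<And>x. \<bar>\<psi> x\<bar> \<le> B"
  shows "(\<lambda>j. \<integral>x. f j x * \<psi> x \<partial>M) \<longlonglongrightarrow> (\<integral>x. u x * \<psi> x \<partial>M)"
proof -
  have i: "integrable M (\<lambda>x. v x * \<psi> x)" if "integrable M v" for v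
  proof (rule Bochner_Integration.integrable_bound)
    show "integrable M (\<lambda>x. B * v x)" using that by simp
    show "(\<lambda>x. v x * \<psi> x) \<in> borel_measurable M" using that \<psi>(1) by measurable
    have "\<bar>v x * \<psi> x\<bar> \<le> \<bar>B * v x\<bar>" for x
      using mult_right_mono[OF order_trans[OF \<psi>(2)[of x] abs_ge_self], of "\<bar>v x\<bar>"]
      by (simp add: abs_mult mult.commute)
    then show "AE x in M. norm (v x * \<psi> x) \<le> norm (B * v x)" by simp
  qed
  have bound: "norm ((\<integral>x. f j x * \<psi> x \<partial>M) - (\<integral>x. u x * \<psi> x \<partial>M)) \<le> B * (\<integral>x. \<bar>f j x - u x\<bar> \<partial>M)" for j
  proof -
    have "(\<integral>x. f j x * \<psi> x \<partial>M) - (\<integral>x. u x * \<psi> x \<partial>M) = (\<integral>x. f j x * \<psi> x - u x * \<psi> x \<partial>M)"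
      by (rule Bochner_Integration.integral_diff[OF i[OF f] i[OF u], symmetric])
    also have "norm \<dots> \<le> (\<integral>x. norm (f j x * \<psi> x - u x * \<psi> x) \<partial>M)"
      by (rule integral_norm_bound)
    also have "\<dots> \<le> (\<integral>x. B * \<bar>f j x - u x\<bar> \<partial>M)"
    proof (rule Bochner_Integration.integral_mono)
      show "norm (f j x * \<psi> x - u x * \<psi> x) \<le> B * \<bar>f j x - u x\<bar>" for x
      proof -
        have "f j x * \<psi> x - u x * \<psi> x = \<psi> x * (f j x - u x)" by (simp add: algebra_simps)
        then show ?thesis
          using mult_right_mono[OF \<psi>(2)[of x], of "\<bar>f j x - u x\<bar>"] by (simp only: real_norm_def abs_mult)
      qed
    qed (use i[OF f] i[OF u] f u in auto)
    finally show ?thesis by simp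
  qed
  have "(\<lambda>j. B * (\<integral>x. \<bar>f j x - u x\<bar> \<partial>M)) \<longlonglongrightarrow> 0"
    using tendsto_mult_left[OF lim, of B] by simp
  from Lim_null_comparison[OF always_eventually[OF allI[OF bound]] this]
  have "(\<lambda>j. (\<integral>x. f j x * \<psi> x \<partial>M) - (\<integral>x. u x * \<psi> x \<partial>M)) \<longlonglongrightarrow> 0" .
  then show ?thesis by (simp add: LIM_zero_iff)
qed

lemma C1c_bounded_measurable:
  assumes \<phi>: "\<phi> \<in> C1c {a<..<b}" and ab: "a < b"
  shows "\<exists>B. \<forall>x. \<bar>\<phi> x\<bar> \<le> B \<and> \<bar>deriv \<phi> x\<bar> \<le> B"
    and "\<phi> \<in> borel_measurable (lebesgue_on S)" "deriv \<phi> \<in> borel_measurable (lebesgue_on S)"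
proof -
  have C1: "\<phi> C1_differentiable_on UNIV" using \<phi> by (auto simp: C1c_def)
  note D = C1_differentiable_on_UNIV_D[OF C1]
  have c: "continuous_on UNIV \<phi>"
    using D(1) by (meson DERIV_continuous_on DERIV_subset top_greatest)
  show "\<phi> \<in> borel_measurable (lebesgue_on S)" "deriv \<phi> \<in> borel_measurable (lebesgue_on S)"
    using borel_measurable_continuous_onI[OF c] borel_measurable_continuous_onI[OF D(2)]
    by (auto intro!: measurable_restrict_space1 measurable_completion)
  obtain c' d' where cd: "a < c'" "c' < d'" "d' < b" and z: "\<And>x. x \<notin> {c'<..<d'} \<Longrightarrow> \<phi> x = 0 \<and> deriv \<phi> x = 0"
    using C1c_Ioo_support[OF \<phi> ab] by blast
  have "\<exists>B. \<forall>x\<in>{c'..d'}. \<bar>f x\<bar> \<le> B" if "continuous_on UNIV f" for f :: "real \<Rightarrow> real"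
    using compact_imp_bounded[OF compact_continuous_image[OF continuous_on_subset[OF that] compact_Icc], of c' d']
    unfolding bounded_iff by auto
  from this[OF c] this[OF D(2)] obtain B1 B2 where B: "\<And>x. x \<in> {c'..d'} \<Longrightarrow> \<bar>\<phi> x\<bar> \<le> B1" "\<And>x. x \<in> {c'..d'} \<Longrightarrow> \<bar>deriv \<phi> x\<bar> \<le> B2"
    by blast
  have "0 \<le> B1" "0 \<le> B2" using B[of c'] cd abs_ge_zero[of "\<phi> c'"] abs_ge_zero[of "deriv \<phi> c'"]
    by (auto intro: order_trans)
  then have "\<bar>\<phi> x\<bar> \<le> B1 + B2 \<and> \<bar>deriv \<phi> x\<bar> \<le> B1 + B2" for x
    using B[of x] z[of x] by (cases "x \<in> {c'..d'}") auto
  then show "\<exists>B. \<forall>x. \<bar>\<phi> x\<bar> \<le> B \<and> \<bar>deriv \<phi> x\<bar> \<le> B" by blast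
qed

lemma has_weak_deriv_L1_limit:
  fixes u v :: "nat \<Rightarrow> real \<Rightarrow> real" and u0 v0 :: "real \<Rightarrow> real"
  assumes ab: "a < b" and w: "\<And>j. has_weak_deriv {a<..<b} (u j) (v j)"
    and i: "\<And>j. integrable (lebesgue_on {a<..<b}) (u j)" "\<And>j. integrable (lebesgue_on {a<..<b}) (v j)"
      "integrable (lebesgue_on {a<..<b}) u0" "integrable (lebesgue_on {a<..<b}) v0"
    and u: "(\<lambda>j. \<integral>x. \<bar>u j x - u0 x\<bar> \<partial>lebesgue_on {a<..<b}) \<longlonglongrightarrow> 0"
    and v: "(\<lambda>j. \<integral>x. \<bar>v j x - v0 x\<bar> \<partial>lebesgue_on {a<..<b}) \<longlonglongrightarrow> 0"
  shows "has_weak_deriv {a<..<b} u0 v0"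
  unfolding has_weak_deriv_def
proof (intro conjI ballI)
  show "loc_integrable_on u0 {a<..<b}" "loc_integrable_on v0 {a<..<b}"
    using i by (auto intro: loc_integrable_on_if_integrable)
  fix \<phi> assume \<phi>: "\<phi> \<in> C1c {a<..<b}"
  note c = C1c_bounded_measurable[OF \<phi> ab]
  obtain B where B: "\<And>x. \<bar>\<phi> x\<bar> \<le> B" "\<And>x. \<bar>deriv \<phi> x\<bar> \<le> B" using c(1) by blast
  have "(\<lambda>j. \<integral>x. u j x * deriv \<phi> x \<partial>lebesgue_on {a<..<b}) \<longlonglongrightarrow> (\<integral>x. u0 x * deriv \<phi> x \<partial>lebesgue_on {a<..<b})"
    by (rule tendsto_integral_mult_if_L1[OF i(1) i(3) u c(3) B(2)])
  moreover have "(\<lambda>j. - (\<integral>x. v j x * \<phi> x \<partial>lebesgue_on {a<..<b})) \<longlonglongrightarrow> - (\<integral>x. v0 x * \<phi> x \<partial>lebesgue_on {a<..<b})"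
    by (intro tendsto_minus tendsto_integral_mult_if_L1[OF i(2) i(4) v c(2) B(1)])
  moreover have "(\<integral>x. u j x * deriv \<phi> x \<partial>lebesgue_on {a<..<b}) = - (\<integral>x. v j x * \<phi> x \<partial>lebesgue_on {a<..<b})" for j
    using w[of j] \<phi> by (auto simp: has_weak_deriv_def)
  ultimately show "(\<integral>x. u0 x * deriv \<phi> x \<partial>lebesgue_on {a<..<b}) = - (\<integral>x. v0 x * \<phi> x \<partial>lebesgue_on {a<..<b})"
    using LIMSEQ_unique by simp
qed

lemma C1c_uminus: "\<phi> \<in> C1c S \<Longrightarrow> (\<lambda>x. - \<phi> x) \<in> C1c S"
  by (auto simp: C1c_def intro: C1_differentiable_on_minus)

text \<open>The constant \<open>\<gamma>\<close> drops out because the derivative of a compactly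
  supported function has integral 0, and the sign of \<open>\<alpha>\<close> is absorbed by
  replacing \<phi> with its negative. This moves bounded variation from
  \<open>\<Phi> \<circ> \<theta>\<close> to \<theta> and on to the derivative of g.\<close>

lemma BV_Ioo_affine:
  fixes u v :: "real \<Rightarrow> real"
  assumes u: "u \<in> BV {a<..<b}" and ab: "a < b" and v: "AE x in lebesgue_on {a<..<b}. v x = \<alpha> * u x + \<gamma>"
  shows "v \<in> BV {a<..<b}"
proof -
  interpret finite_measure "lebesgue_on {a<..<b}" by (rule finite_measure_lebesgue_on_Ioo)
  have iu: "integrable (lebesgue_on {a<..<b}) u" and TV: "total_variation {a<..<b} u < \<infinity>"
    using u by (auto simp: BV_def L1_on_def)
  have iv: "integrable (lebesgue_on {a<..<b}) v"
  proof -
    obtain N where N: "negligible N" "\<And>x. x \<in> {a<..<b} \<Longrightarrow> x \<notin> N \<Longrightarrow> v x = \<alpha> * u x + \<gamma>"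
      using AE_lebesgue_onE[OF v] by auto
    have "integrable (lebesgue_on {a<..<b}) (\<lambda>x. \<alpha> * u x + \<gamma>)" using iu by simp
    then have i: "(\<lambda>x. \<alpha> * u x + \<gamma>) absolutely_integrable_on {a..b}" by (simp only: integrable_lebesgue_on_Ioo_iff)
    have "negligible (N \<union> {a, b})" using N(1) by (intro negligible_Un) auto
    from absolutely_integrable_spike[OF i this] have "v absolutely_integrable_on {a..b}" using N(2) by auto
    then show ?thesis by (simp only: integrable_lebesgue_on_Ioo_iff)
  qed
  have TV_v: "total_variation {a<..<b} v \<le> ennreal \<bar>\<alpha>\<bar> * total_variation {a<..<b} u"
    unfolding total_variation_def[of _ v]
  proof (rule SUP_least)
    fix \<phi> assume \<phi>: "\<phi> \<in> {\<phi> \<in> C1c {a<..<b}. \<forall>x. \<bar>\<phi> x\<bar> \<le> 1}"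
    then have \<phi>c: "\<phi> \<in> C1c {a<..<b}" by blast
    have D: "(\<phi> has_real_derivative deriv \<phi> x) (at x)" "continuous_on UNIV (deriv \<phi>)" for x
      using \<phi>c C1_differentiable_on_UNIV_D by (auto simp: C1c_def)
    note c = C1c_bounded_measurable[OF \<phi>c ab]
    obtain B where B: "\<And>x. \<bar>deriv \<phi> x\<bar> \<le> B" using c(1) by blast
    have i1: "integrable (lebesgue_on {a<..<b}) (deriv \<phi>)"
      by (rule integrable_const_bound[of _ B]) (use B c(3) in auto)
    have i2: "integrable (lebesgue_on {a<..<b}) (\<lambda>x. u x * deriv \<phi> x)"
      using absolutely_integrable_continuous_mult[of a b "deriv \<phi>" u] iu D(2) continuous_on_subset
      by (fastforce simp: integrable_lebesgue_on_Ioo_iff mult.commute)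
    obtain c' d' where cd: "a < c'" "c' < d'" "d' < b" and z: "\<And>x. x \<notin> {c'<..<d'} \<Longrightarrow> \<phi> x = 0 \<and> deriv \<phi> x = 0"
      using C1c_Ioo_support[OF \<phi>c ab] by blast
    have "(deriv \<phi> has_integral \<phi> b - \<phi> a) {a..b}"
      using ab D(1) by (intro fundamental_theorem_of_calculus)
        (auto simp: has_real_derivative_iff_has_vector_derivative[symmetric] intro: DERIV_subset)
    then have zero: "(\<integral>x. deriv \<phi> x \<partial>lebesgue_on {a<..<b}) = 0"
      using z[of a] z[of b] cd i1 by (simp add: integral_lebesgue_on_Ioo integrable_lebesgue_on_Ioo_iff integral_unique)
    have "(\<integral>x. v x * deriv \<phi> x \<partial>lebesgue_on {a<..<b}) = (\<integral>x. \<alpha> * (u x * deriv \<phi> x) + \<gamma> * deriv \<phi> x \<partial>lebesgue_on {a<..<b})"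
      using v iv iu c(3) by (intro integral_cong_AE) (auto simp: algebra_simps elim!: eventually_mono)
    also have "\<dots> = \<alpha> * (\<integral>x. u x * deriv \<phi> x \<partial>lebesgue_on {a<..<b})"
      using i1 i2 zero by simp
    also have "ennreal \<dots> \<le> ennreal \<bar>\<alpha>\<bar> * total_variation {a<..<b} u"
    proof -
      define \<psi> where "\<psi> = (if \<alpha> \<ge> 0 then \<phi> else (\<lambda>x. - \<phi> x))"
      have \<psi>: "\<psi> \<in> {\<phi> \<in> C1c {a<..<b}. \<forall>x. \<bar>\<phi> x\<bar> \<le> 1}"
        using \<phi> C1c_uminus[OF \<phi>c] by (auto simp: \<psi>_def)
      have "deriv (\<lambda>x. - \<phi> x) x = - deriv \<phi> x" for x
        by (rule DERIV_imp_deriv, rule DERIV_minus, rule D(1))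
      then have "\<alpha> * (\<integral>x. u x * deriv \<phi> x \<partial>lebesgue_on {a<..<b}) = \<bar>\<alpha>\<bar> * (\<integral>x. u x * deriv \<psi> x \<partial>lebesgue_on {a<..<b})"
        by (simp add: \<psi>_def)
      also have "ennreal \<dots> = ennreal \<bar>\<alpha>\<bar> * ennreal (\<integral>x. u x * deriv \<psi> x \<partial>lebesgue_on {a<..<b})"
        by (simp add: ennreal_mult')
      also have "\<dots> \<le> ennreal \<bar>\<alpha>\<bar> * total_variation {a<..<b} u"
        unfolding total_variation_def by (intro mult_left_mono SUP_upper \<psi>) auto
      finally show ?thesis .
    qed
    finally show "ennreal (\<integral>x. v x * deriv \<phi> x \<partial>lebesgue_on {a<..<b}) \<le> ennreal \<bar>\<alpha>\<bar> * total_variation {a<..<b} u" .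
  qed
  have "ennreal \<bar>\<alpha>\<bar> * total_variation {a<..<b} u < \<infinity>"
    using TV by (simp add: ennreal_mult_less_top)
  then show ?thesis using iv TV_v by (auto simp: BV_def L1_on_def intro: le_less_trans)
qed

section \<open>Compactness and the lower bound\<close>

text \<open>Expand the square of \<open>\<epsilon> * \<bar>v\<bar> - sqrt w\<close> and divide by
  \<epsilon>.\<close>

lemma two_sqrt_mult_le:
  assumes "\<epsilon> > 0" "w \<ge> 0"
  shows "2 * sqrt w * \<bar>v\<bar> \<le> \<epsilon> * v\<^sup>2 + 1 / \<epsilon> * w"
proof -
  have "0 \<le> (\<epsilon> * \<bar>v\<bar> - sqrt w)\<^sup>2 / \<epsilon>" using assms by simp
  also have "\<dots> = \<epsilon> * v\<^sup>2 - 2 * sqrt w * \<bar>v\<bar> + 1 / \<epsilon> * w"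
    using assms by (simp add: power2_diff power_mult_distrib field_simps power2_eq_square)
  finally show ?thesis by simp
qed

text \<open>All six terms of the integrand are nonnegative, so any of them may be dropped. The three
  selections serve the variation of \<open>\<Phi> \<circ> \<theta>\<close>, the constraint on the
  derivative of g, and the confinement to the wells.\<close>

lemma F_C_lower_bounds:
  assumes pos: "\<sigma> > 0" "D1 > 0" "D2 > 0" "\<epsilon> > 0"
  shows "(\<integral>\<^sup>+x. ennreal (\<epsilon> * (weak_deriv {-l<..<l} \<theta> x)\<^sup>2 + 1 / \<epsilon> * W \<sigma> D2 (\<theta> x)) \<partial>lebesgue_on {-l<..<l})
      \<le> F_C \<sigma> D1 D2 l \<epsilon> \<theta> g"
    and "(\<integral>\<^sup>+x. ennreal (1 / \<epsilon> * (weak_deriv {-l<..<l} g x + sin (\<theta> x))\<^sup>2) \<partial>lebesgue_on {-l<..<l})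
      \<le> F_C \<sigma> D1 D2 l \<epsilon> \<theta> g"
    and "(\<integral>\<^sup>+x. ennreal (1 / \<epsilon> * W \<sigma> D2 (\<theta> x)) \<partial>lebesgue_on {-l<..<l}) \<le> F_C \<sigma> D1 D2 l \<epsilon> \<theta> g"
proof -
  have nn: "0 \<le> D1 * \<epsilon> * (p + q * r)\<^sup>2" "0 \<le> D2 / (2 * \<epsilon>) * (p + q) ^ 4" "0 \<le> 1 / \<epsilon> * (p + q)\<^sup>2"
    "0 \<le> 4 * D2 / \<epsilon> * (p + q)\<^sup>2 * s ^ 4" "0 \<le> \<epsilon> * p\<^sup>2" "0 \<le> 1 / \<epsilon> * W \<sigma> D2 p" for p q r s :: real
    using pos W_wells(1)[OF pos(1,3), of p] by simp_all
  have s: "t5 + t6 \<le> t1 + t2 + t3 + t4 + t5 + t6" "t3 \<le> t1 + t2 + t3 + t4 + t5 + t6" "t6 \<le> t1 + t2 + t3 + t4 + t5 + t6"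
    if "0 \<le> t1" "0 \<le> t2" "0 \<le> t3" "0 \<le> t4" "0 \<le> t5" "0 \<le> t6" for t1 t2 t3 t4 t5 t6 :: real
    using that by auto
  show "(\<integral>\<^sup>+x. ennreal (\<epsilon> * (weak_deriv {-l<..<l} \<theta> x)\<^sup>2 + 1 / \<epsilon> * W \<sigma> D2 (\<theta> x)) \<partial>lebesgue_on {-l<..<l})
      \<le> F_C \<sigma> D1 D2 l \<epsilon> \<theta> g"
    and "(\<integral>\<^sup>+x. ennreal (1 / \<epsilon> * (weak_deriv {-l<..<l} g x + sin (\<theta> x))\<^sup>2) \<partial>lebesgue_on {-l<..<l})
      \<le> F_C \<sigma> D1 D2 l \<epsilon> \<theta> g"
    and "(\<integral>\<^sup>+x. ennreal (1 / \<epsilon> * W \<sigma> D2 (\<theta> x)) \<partial>lebesgue_on {-l<..<l}) \<le> F_C \<sigma> D1 D2 l \<epsilon> \<theta> g"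
    unfolding F_C_def Let_def
    by (rule nn_integral_mono, rule ennreal_leI, rule s; rule nn)+
qed

text \<open>The last integrand is the modulus of the derivative of \<open>Phi\<close> along \<rho>,
  so M bounds a variation independently of \<epsilon>. The square integrable v agrees almost
  everywhere with the representative chosen by \<open>weak_deriv\<close>, in which the energy is
  written.\<close>

lemma Y_C_AC_representative:
  assumes pos: "\<sigma> > 0" "D1 > 0" "D2 > 0" "l > 0" "\<epsilon> > 0"
    and Y: "(\<theta>, g) \<in> Y_C l" and F: "F_C \<sigma> D1 D2 l \<epsilon> \<theta> g \<le> ennreal M" and M: "M \<ge> 0"
  shows "\<exists>\<rho> v. continuous_on {-l..l} \<rho> \<and> (AE x in lebesgue_on {-l<..<l}. \<theta> x = \<rho> x) \<and> \<rho> (-l) = \<rho> l \<and>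
    v absolutely_integrable_on {-l..l} \<and>
    (\<forall>x y. -l \<le> x \<longrightarrow> x \<le> y \<longrightarrow> y \<le> l \<longrightarrow> integral {x..y} v = \<rho> y - \<rho> x) \<and>
    integral {-l..l} (\<lambda>t. \<bar>2 * sqrt (W \<sigma> D2 (\<rho> t)) * v t\<bar>) \<le> M"
proof -
  from Y obtain \<rho> where \<rho>: "continuous_on {-l..l} \<rho>" "AE x in lebesgue_on {-l<..<l}. \<theta> x = \<rho> x" "\<rho> (-l) = \<rho> l"
    by (auto simp: Y_C_def periodic_bdry_def)
  from Y obtain v where v: "v \<in> L2_on {-l<..<l}" "has_weak_deriv {-l<..<l} \<theta> v"
    by (auto simp: Y_C_def W12_def)
  have av: "v absolutely_integrable_on {-l..l}"
    using L2_on_Ioo_integrable[OF v(1)] by (simp add: integrable_lebesgue_on_Ioo_iff)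
  have inc: "integral {x..y} v = \<rho> y - \<rho> x" if "-l \<le> x" "x \<le> y" "y \<le> l" for x y
    using that pos by (intro has_weak_deriv_increment[OF v(2) \<rho>(2,1) av]) auto
  have v': "AE x in lebesgue_on {-l<..<l}. v x = weak_deriv {-l<..<l} \<theta> x"
    using pos by (intro has_weak_deriv_unique[OF v(2) has_weak_deriv_weak_deriv[OF v(2)]]) auto
  let ?h = "\<lambda>t. \<bar>2 * sqrt (W \<sigma> D2 (\<rho> t)) * v t\<bar>"
  have "(\<lambda>t. 2 * sqrt (W \<sigma> D2 (\<rho> t)) * v t) absolutely_integrable_on {-l..l}"
    by (intro absolutely_integrable_continuous_mult av continuous_intros \<rho>)
  then have h: "?h absolutely_integrable_on {-l..l}"
    using absolutely_integrable_abs by fastforce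
  have "ennreal (integral {-l..l} ?h) = ennreal (\<integral>t. ?h t \<partial>lebesgue_on {-l<..<l})"
    by (simp only: integral_lebesgue_on_Ioo[OF h])
  also have "\<dots> = (\<integral>\<^sup>+t. ennreal (?h t) \<partial>lebesgue_on {-l<..<l})"
    using h by (intro nn_integral_eq_integral[symmetric]) (auto simp only: integrable_lebesgue_on_Ioo_iff abs_ge_zero intro: AE_I2)
  also have "\<dots> \<le> (\<integral>\<^sup>+x. ennreal (\<epsilon> * (weak_deriv {-l<..<l} \<theta> x)\<^sup>2 + 1 / \<epsilon> * W \<sigma> D2 (\<theta> x)) \<partial>lebesgue_on {-l<..<l})"
  proof (rule nn_integral_mono_AE)
    have bound: "?h x \<le> \<epsilon> * (v x)\<^sup>2 + 1 / \<epsilon> * W \<sigma> D2 (\<rho> x)" for x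
      using two_sqrt_mult_le[OF pos(5) W_wells(1)[OF pos(1,3)], of "\<rho> x" "v x"] W_wells(1)[OF pos(1,3), of "\<rho> x"]
      by (simp add: abs_mult)
    from \<rho>(2) v' show "AE x in lebesgue_on {-l<..<l}. ennreal (?h x) \<le> ennreal (\<epsilon> * (weak_deriv {-l<..<l} \<theta> x)\<^sup>2 + 1 / \<epsilon> * W \<sigma> D2 (\<theta> x))"
    proof eventually_elim
      case (elim x)
      then show ?case using bound[of x] by (intro ennreal_leI) simp
    qed
  qed
  also have "\<dots> \<le> ennreal M"
    using F_C_lower_bounds(1)[OF pos(1-3,5)] F by (rule order_trans)
  finally have "integral {-l..l} ?h \<le> M" using M by simp
  with \<rho> av inc show ?thesis by blast
qed

text \<open>The integral of \<open>W\<close> along the sequence is at most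
  \<open>\<epsilon> j * M\<close>. Fatou's lemma then gives integral 0 for \<open>W\<close> along
  the limit.\<close>

lemma bounded_energy_limit_in_wells:
  fixes \<theta> :: "real \<Rightarrow> real" and \<theta>s gs :: "nat \<Rightarrow> real \<Rightarrow> real"
  assumes pos: "\<sigma> > 0" "D1 > 0" "D2 > 0" and \<epsilon>: "\<And>j. \<epsilon> j > 0" "\<epsilon> \<longlonglongrightarrow> 0"
    and \<theta>: "\<theta> \<in> borel_measurable (lebesgue_on {-l<..<l})" "AE x in lebesgue_on {-l<..<l}. \<theta> x \<in> {-pi..pi}"
    and \<theta>s: "\<And>j. \<theta>s j \<in> borel_measurable (lebesgue_on {-l<..<l})"
    and lim: "AE x in lebesgue_on {-l<..<l}. (\<lambda>n. \<theta>s n x) \<longlonglongrightarrow> \<theta> x"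
    and F: "\<And>j. F_C \<sigma> D1 D2 l (\<epsilon> j) (\<theta>s j) (gs j) \<le> ennreal M"
  shows "AE x in lebesgue_on {-l<..<l}. \<theta> x \<in> {- well \<sigma> D2, well \<sigma> D2}"
proof -
  note [measurable] = \<theta>(1) \<theta>s
  have cW: "continuous_on UNIV (W \<sigma> D2)" using continuous_on_W[OF continuous_on_id] by simp
  have [measurable]: "W \<sigma> D2 \<in> borel_measurable borel"
    by (rule borel_measurable_continuous_onI[OF cW])
  have Wj: "(\<integral>\<^sup>+x. ennreal (W \<sigma> D2 (\<theta>s j x)) \<partial>lebesgue_on {-l<..<l}) \<le> ennreal (\<epsilon> j) * ennreal M" for j
  proof -
    have "(\<integral>\<^sup>+x. ennreal (W \<sigma> D2 (\<theta>s j x)) \<partial>lebesgue_on {-l<..<l})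
       = (\<integral>\<^sup>+x. ennreal (\<epsilon> j) * ennreal (1 / \<epsilon> j * W \<sigma> D2 (\<theta>s j x)) \<partial>lebesgue_on {-l<..<l})"
      using \<epsilon>(1)[of j] W_wells(1)[OF pos(1,3)] by (intro nn_integral_cong) (simp flip: ennreal_mult)
    also have "\<dots> = ennreal (\<epsilon> j) * (\<integral>\<^sup>+x. ennreal (1 / \<epsilon> j * W \<sigma> D2 (\<theta>s j x)) \<partial>lebesgue_on {-l<..<l})"
      by (rule nn_integral_cmult) measurable
    also have "\<dots> \<le> ennreal (\<epsilon> j) * ennreal M"
      using F_C_lower_bounds(3)[OF pos \<epsilon>(1)[of j], where \<theta> = "\<theta>s j" and g = "gs j" and l = l] F[of j] by (intro mult_left_mono) (rule order_trans, auto)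
    finally show ?thesis .
  qed
  have "(\<integral>\<^sup>+x. ennreal (W \<sigma> D2 (\<theta> x)) \<partial>lebesgue_on {-l<..<l})
     = (\<integral>\<^sup>+x. liminf (\<lambda>n. ennreal (W \<sigma> D2 (\<theta>s n x))) \<partial>lebesgue_on {-l<..<l})"
  proof (rule nn_integral_cong_AE)
    show "AE x in lebesgue_on {-l<..<l}. ennreal (W \<sigma> D2 (\<theta> x)) = liminf (\<lambda>n. ennreal (W \<sigma> D2 (\<theta>s n x)))"
      using lim
    proof eventually_elim
      case (elim x)
      have "isCont (W \<sigma> D2) (\<theta> x)" using cW by (simp add: continuous_on_eq_continuous_at)
      then have "(\<lambda>n. W \<sigma> D2 (\<theta>s n x)) \<longlonglongrightarrow> W \<sigma> D2 (\<theta> x)" by (rule isCont_tendsto_compose) (rule elim)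
      then show ?case by (intro lim_imp_Liminf[symmetric] tendsto_ennrealI) auto
    qed
  qed
  also have "\<dots> \<le> liminf (\<lambda>n. \<integral>\<^sup>+x. ennreal (W \<sigma> D2 (\<theta>s n x)) \<partial>lebesgue_on {-l<..<l})"
    by (rule nn_integral_liminf) measurable
  also have "\<dots> \<le> liminf (\<lambda>n. ennreal (\<epsilon> n) * ennreal M)"
    by (intro Liminf_mono always_eventually allI Wj)
  also have "\<dots> = 0"
  proof -
    have "(\<lambda>n. ennreal (\<epsilon> n * M)) \<longlonglongrightarrow> ennreal (0 * M)"
      by (intro tendsto_ennrealI tendsto_mult \<epsilon>(2) tendsto_const)
    then have "(\<lambda>n. ennreal (\<epsilon> n) * ennreal M) \<longlonglongrightarrow> 0"
      using \<epsilon>(1) by (simp add: ennreal_mult' less_imp_le)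
    then show ?thesis by (simp add: lim_imp_Liminf)
  qed
  finally have "AE x in lebesgue_on {-l<..<l}. ennreal (W \<sigma> D2 (\<theta> x)) = 0"
    by (subst (asm) le_zero_eq, subst (asm) nn_integral_0_iff_AE) auto
  with \<theta>(2) show ?thesis
  proof eventually_elim
    case (elim x)
    then have "W \<sigma> D2 (\<theta> x) = 0" using W_wells(1)[OF pos(1,3), of "\<theta> x"] by (simp add: ennreal_eq_0_iff)
    \<comment> \<open>\<open>W\<close> is 2 pi periodic and has further zeros elsewhere; the range
      of \<theta> enters here to leave only the two wells.\<close>
    then show ?case using W_wells(2)[OF pos(1,3)] elim(1) by blast
  qed
qed

lemma abs_sin_diff_le: "\<bar>sin x - sin y\<bar> \<le> \<bar>x - y :: real\<bar>"
proof -
  have "norm (sin x - sin y) \<le> 1 * norm (x - y)"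
    by (rule field_differentiable_bound[of UNIV sin cos]) (auto intro: DERIV_subset[OF DERIV_sin])
  then show ?thesis by simp
qed

text \<open>The defect \<open>e j\<close>, the derivative of \<open>gs j\<close> plus the sine of
  \<open>\<theta>s j\<close>, has squared L2 norm at most \<open>\<epsilon> j * M\<close>, so it
  tends to 0 in L1. Since sine is 1-Lipschitz, the derivatives of \<open>gs j\<close> converge in
  L1, which is enough to pass to the limit in the weak formulation.\<close>

lemma bounded_energy_derivative_limit:
  fixes \<theta> g :: "real \<Rightarrow> real" and \<theta>s gs :: "nat \<Rightarrow> real \<Rightarrow> real"
  assumes pos: "\<sigma> > 0" "D1 > 0" "D2 > 0" "l > 0" and \<epsilon>: "\<And>j. \<epsilon> j > 0" "\<epsilon> \<longlonglongrightarrow> 0"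
    and \<theta>: "\<theta> \<in> L1_on {-l<..<l}" and g: "g \<in> L2_on {-l<..<l}"
    and Y: "\<And>j. (\<theta>s j, gs j) \<in> Y_C l"
    and \<theta>_lim: "(\<lambda>j. L1_dist {-l<..<l} (\<theta>s j) \<theta>) \<longlonglongrightarrow> 0"
    and g_lim: "(\<lambda>j. L2_dist {-l<..<l} (gs j) g) \<longlonglongrightarrow> 0"
    and F: "\<And>j. F_C \<sigma> D1 D2 l (\<epsilon> j) (\<theta>s j) (gs j) \<le> ennreal M" and M: "M \<ge> 0"
  shows "has_weak_deriv {-l<..<l} g (\<lambda>x. - sin (\<theta> x))"
    and "(\<integral>x. sin (\<theta> x) \<partial>lebesgue_on {-l<..<l}) = 0"
proof -
  let ?I = "{-l<..<l}"
  interpret finite_measure "lebesgue_on ?I" by (rule finite_measure_lebesgue_on_Ioo)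
  define dg where "dg = (\<lambda>j. weak_deriv ?I (gs j))"
  have \<theta>sL2: "\<theta>s j \<in> L2_on ?I" and gsL2: "gs j \<in> L2_on ?I" and dgL2: "dg j \<in> L2_on ?I" for j
    using Y[of j] by (auto simp: Y_C_def W12_def W22_def dg_def)
  have wd: "has_weak_deriv ?I (gs j) (dg j)" for j
    using Y[of j] by (auto simp: Y_C_def W12_def W22_def dg_def intro: has_weak_deriv_weak_deriv)
  have [measurable]: "\<theta> \<in> borel_measurable (lebesgue_on ?I)" "\<theta>s j \<in> borel_measurable (lebesgue_on ?I)" for j
    using \<theta> \<theta>sL2[of j] by (auto simp: L1_on_def L2_on_def)
  have sin_L2: "(\<lambda>x. sin (f x)) \<in> L2_on ?I" if "f \<in> borel_measurable (lebesgue_on ?I)" for f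
    using that by (intro bounded_measurable_in_L2_on_Ioo[of _ _ _ 1]) auto
  have msin: "(\<lambda>x. - sin (\<theta> x)) \<in> L2_on ?I" by (intro L2_on_uminus sin_L2) measurable
  define e where "e = (\<lambda>j x. dg j x + sin (\<theta>s j x))"
  have eL2: "e j \<in> L2_on ?I" for j
    using L2_on_diff[OF dgL2[of j] L2_on_uminus[OF sin_L2[of "\<theta>s j"]]] by (simp add: e_def)
  have e2: "(\<integral>x. (e j x)\<^sup>2 \<partial>lebesgue_on ?I) \<le> \<epsilon> j * M" for j
  proof -
    have i: "integrable (lebesgue_on ?I) (\<lambda>x. 1 / \<epsilon> j * (e j x)\<^sup>2)"
      using eL2[of j] by (intro integrable_mult_right) (simp add: L2_on_def)
    have "ennreal (\<integral>x. 1 / \<epsilon> j * (e j x)\<^sup>2 \<partial>lebesgue_on ?I) = (\<integral>\<^sup>+x. ennreal (1 / \<epsilon> j * (e j x)\<^sup>2) \<partial>lebesgue_on ?I)"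
      using \<epsilon>(1)[of j] by (intro nn_integral_eq_integral[symmetric] i AE_I2) auto
    also have "\<dots> \<le> ennreal M"
      using F_C_lower_bounds(2)[OF pos(1-3) \<epsilon>(1)[of j], where \<theta> = "\<theta>s j" and g = "gs j" and l = l] F[of j]
      unfolding e_def dg_def by (rule order_trans)
    finally have "1 / \<epsilon> j * (\<integral>x. (e j x)\<^sup>2 \<partial>lebesgue_on ?I) \<le> M" using M by simp
    then show ?thesis using \<epsilon>(1)[of j] by (simp add: field_simps)
  qed
  have e1: "(\<integral>x. \<bar>e j x\<bar> \<partial>lebesgue_on ?I) \<le> sqrt (2 * l * (\<epsilon> j * M))" for j
  proof -
    have "(\<integral>x. \<bar>e j x\<bar> \<partial>lebesgue_on ?I) \<le> sqrt ((l - - l) * (\<integral>x. (e j x)\<^sup>2 \<partial>lebesgue_on ?I))"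
      using pos by (intro L1_le_L2 eL2) auto
    also have "\<dots> \<le> sqrt (2 * l * (\<epsilon> j * M))"
      using e2[of j] pos by (intro real_sqrt_le_mono) (simp add: mult_left_mono)
    finally show ?thesis .
  qed
  have dg_lim: "(\<lambda>j. \<integral>x. \<bar>dg j x - - sin (\<theta> x)\<bar> \<partial>lebesgue_on ?I) \<longlonglongrightarrow> 0"
  proof (rule Lim_null_comparison)
    show "\<forall>\<^sub>F j in sequentially. norm (\<integral>x. \<bar>dg j x - - sin (\<theta> x)\<bar> \<partial>lebesgue_on ?I)
        \<le> sqrt (2 * l * (\<epsilon> j * M)) + L1_dist ?I (\<theta>s j) \<theta>"
    proof (intro always_eventually allI)
      fix j
      have i\<theta>: "integrable (lebesgue_on ?I) (\<lambda>x. \<bar>\<theta>s j x - \<theta> x\<bar>)"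
        using L2_on_Ioo_integrable[OF \<theta>sL2[of j]] \<theta> by (auto simp: L1_on_def)
      have ie: "integrable (lebesgue_on ?I) (\<lambda>x. \<bar>e j x\<bar>)" using L2_on_Ioo_integrable[OF eL2[of j]] by auto
      have "(\<integral>x. \<bar>dg j x - - sin (\<theta> x)\<bar> \<partial>lebesgue_on ?I) \<le> (\<integral>x. \<bar>e j x\<bar> + \<bar>\<theta>s j x - \<theta> x\<bar> \<partial>lebesgue_on ?I)"
      proof (rule Bochner_Integration.integral_mono)
        show "integrable (lebesgue_on ?I) (\<lambda>x. \<bar>dg j x - - sin (\<theta> x)\<bar>)"
          using L2_on_Ioo_integrable[OF L2_on_diff[OF dgL2[of j] msin]] by auto
        show "\<bar>dg j x - - sin (\<theta> x)\<bar> \<le> \<bar>e j x\<bar> + \<bar>\<theta>s j x - \<theta> x\<bar>" for x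
          using abs_sin_diff_le[of "\<theta>s j x" "\<theta> x"] by (simp add: e_def)
      qed (use i\<theta> ie in auto)
      also have "\<dots> = (\<integral>x. \<bar>e j x\<bar> \<partial>lebesgue_on ?I) + L1_dist ?I (\<theta>s j) \<theta>"
        unfolding L1_dist_def by (rule Bochner_Integration.integral_add[OF ie i\<theta>])
      finally show "norm (\<integral>x. \<bar>dg j x - - sin (\<theta> x)\<bar> \<partial>lebesgue_on ?I) \<le> sqrt (2 * l * (\<epsilon> j * M)) + L1_dist ?I (\<theta>s j) \<theta>"
        using e1[of j] by simp
    qed
    have "(\<lambda>j. sqrt (2 * l * (\<epsilon> j * M)) + L1_dist ?I (\<theta>s j) \<theta>) \<longlonglongrightarrow> sqrt (2 * l * (0 * M)) + 0"
      by (intro tendsto_intros \<epsilon>(2) \<theta>_lim)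
    then show "(\<lambda>j. sqrt (2 * l * (\<epsilon> j * M)) + L1_dist ?I (\<theta>s j) \<theta>) \<longlonglongrightarrow> 0" by simp
  qed
  have gs_lim: "(\<lambda>j. \<integral>x. \<bar>gs j x - g x\<bar> \<partial>lebesgue_on ?I) \<longlonglongrightarrow> 0"
  proof (rule Lim_null_comparison)
    have "(\<integral>x. \<bar>gs j x - g x\<bar> \<partial>lebesgue_on ?I) \<le> sqrt (2 * l) * L2_dist ?I (gs j) g" for j
    proof -
      have "(\<integral>x. \<bar>gs j x - g x\<bar> \<partial>lebesgue_on ?I) \<le> sqrt ((l - - l) * (\<integral>x. (gs j x - g x)\<^sup>2 \<partial>lebesgue_on ?I))"
        using pos by (intro L1_le_L2 L2_on_diff gsL2 g) auto
      then show ?thesis by (simp add: L2_dist_def real_sqrt_mult)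
    qed
    then show "\<forall>\<^sub>F j in sequentially. norm (\<integral>x. \<bar>gs j x - g x\<bar> \<partial>lebesgue_on ?I) \<le> sqrt (2 * l) * L2_dist ?I (gs j) g"
      by simp
    show "(\<lambda>j. sqrt (2 * l) * L2_dist ?I (gs j) g) \<longlonglongrightarrow> 0"
      using tendsto_mult_left[OF g_lim, of "sqrt (2 * l)"] by simp
  qed
  note int = L2_on_Ioo_integrable[OF gsL2] L2_on_Ioo_integrable[OF dgL2] L2_on_Ioo_integrable[OF g] L2_on_Ioo_integrable[OF msin]
  show "has_weak_deriv ?I g (\<lambda>x. - sin (\<theta> x))"
    using pos by (intro has_weak_deriv_L1_limit[OF _ wd int gs_lim dg_lim]) auto
  \<comment> \<open>The constant 1 is no compactly supported test function; the increment formula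
    over the closed interval and the periodicity of \<open>gs j\<close> replace it. The factor 1
    matches the shape of the L1 limit lemma used below.\<close>
  have "(\<integral>x. dg j x * 1 \<partial>lebesgue_on ?I) = 0" for j
  proof -
    from Y[of j] obtain \<rho> where \<rho>: "continuous_on {-l..l} \<rho>" "AE x in lebesgue_on ?I. gs j x = \<rho> x" "\<rho> (-l) = \<rho> l"
      by (auto simp: Y_C_def periodic_bdry_def)
    have a: "dg j absolutely_integrable_on {-l..l}" using int(2)[of j] by (simp add: integrable_lebesgue_on_Ioo_iff)
    have "integral {-l..l} (dg j) = \<rho> l - \<rho> (-l)"
      using pos by (intro has_weak_deriv_increment[OF wd \<rho>(2,1) a]) auto
    then show ?thesis using \<rho>(3) by (simp add: integral_lebesgue_on_Ioo[OF a])
  qed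
  moreover have "(\<lambda>j. \<integral>x. dg j x * 1 \<partial>lebesgue_on ?I) \<longlonglongrightarrow> (\<integral>x. - sin (\<theta> x) * 1 \<partial>lebesgue_on ?I)"
    by (rule tendsto_integral_mult_if_L1[OF int(2) int(4) dg_lim, of _ 1]) auto
  ultimately have "(\<lambda>j. 0) \<longlonglongrightarrow> - (\<integral>x. sin (\<theta> x) \<partial>lebesgue_on ?I)" by simp
  then show "(\<integral>x. sin (\<theta> x) \<partial>lebesgue_on ?I) = 0" by (simp add: LIMSEQ_const_iff)
qed

text \<open>Stated with one real bound M for all energies instead of a liminf, so that membership in
  \<open>A_C\<close> and the inequality come from the same estimates.\<close>

lemma bounded_energy_lower_bound:
  fixes \<theta> g :: "real \<Rightarrow> real" and \<theta>s gs :: "nat \<Rightarrow> real \<Rightarrow> real"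
  assumes pos: "\<sigma> > 0" "D1 > 0" "D2 > 0" "l > 0" and \<epsilon>: "\<And>j. \<epsilon> j > 0" "\<epsilon> \<longlonglongrightarrow> 0"
    and \<theta>: "\<theta> \<in> L1_on {-l<..<l}" and g: "g \<in> L2_on {-l<..<l}"
    and \<theta>pi: "AE x in lebesgue_on {-l<..<l}. \<theta> x \<in> {-pi..pi}"
    and Y: "\<And>j. (\<theta>s j, gs j) \<in> Y_C l"
    and \<theta>_lim: "(\<lambda>j. L1_dist {-l<..<l} (\<theta>s j) \<theta>) \<longlonglongrightarrow> 0"
    and g_lim: "(\<lambda>j. L2_dist {-l<..<l} (gs j) g) \<longlonglongrightarrow> 0"
    and F: "\<And>j. F_C \<sigma> D1 D2 l (\<epsilon> j) (\<theta>s j) (gs j) \<le> ennreal M" and M: "M \<ge> 0"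
  shows "(\<theta>, g) \<in> A_C l" and "G0_C \<sigma> D2 l \<theta> g \<le> ennreal M"
proof -
  let ?I = "{-l<..<l}"
  define \<beta> where "\<beta> = well \<sigma> D2"
  define \<Phi> where "\<Phi> = Phi \<sigma> D2"
  define P where "P = \<Phi> \<beta>"
  have ll: "- l < l" using pos by simp
  have \<beta>: "0 < \<beta>" "\<beta> < pi / 2" using W_wells(2)[OF pos(1,3)] by (auto simp: \<beta>_def)
  have \<Phi>\<beta>: "\<Phi> (- \<beta>) = 0" "\<Phi> \<beta> = P" "P > 0"
    using Phi_minus_well Phi_well_pos[OF pos(1,3)] by (auto simp: P_def \<Phi>_def \<beta>_def)
  have d\<Phi>: "(\<Phi> has_real_derivative 2 * sqrt (W \<sigma> D2 s)) (at s)" for s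
    unfolding \<Phi>_def by (rule Phi_deriv)
  have c\<Phi>: "continuous_on UNIV \<Phi>"
    using d\<Phi> by (meson DERIV_continuous_on DERIV_subset top_greatest)
  have c\<psi>: "continuous_on UNIV (\<lambda>s. 2 * sqrt (W \<sigma> D2 s))" by (intro continuous_intros)
  have [measurable]: "\<Phi> \<in> borel_measurable borel" by (rule borel_measurable_continuous_onI[OF c\<Phi>])
  obtain K where K: "K \<ge> 0" "\<And>x y. \<bar>\<Phi> x - \<Phi> y\<bar> \<le> K * \<bar>x - y\<bar>"
    using Phi_Lipschitz[OF pos(1,3)] unfolding \<Phi>_def by blast
  interpret finite_measure "lebesgue_on ?I" by (rule finite_measure_lebesgue_on_Ioo)

  have i\<theta>: "integrable (lebesgue_on ?I) \<theta>" using \<theta> by (simp add: L1_on_def)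
  have i\<theta>s: "integrable (lebesgue_on ?I) (\<theta>s j)" for j
    using Y[of j] by (intro L2_on_Ioo_integrable) (auto simp: Y_C_def W12_def)
  have [measurable]: "\<theta> \<in> borel_measurable (lebesgue_on ?I)" "\<theta>s j \<in> borel_measurable (lebesgue_on ?I)" for j
    using i\<theta> i\<theta>s by auto
  \<comment> \<open>The subsequence r serves only the pointwise statements: the values of \<theta>
    and its constancy near the ends. The variation bound keeps the full sequence, which converges in
    L1.\<close>
  obtain r :: "nat \<Rightarrow> nat" where r: "strict_mono r" "AE x in lebesgue_on ?I. (\<lambda>n. \<theta>s (r n) x - \<theta> x) \<longlonglongrightarrow> 0"
    using tendsto_L1_AE_subseq[of "lebesgue_on ?I" "\<lambda>j x. \<theta>s j x - \<theta> x"] i\<theta> i\<theta>s \<theta>_lim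
    by (auto simp: L1_dist_def)
  have lim: "AE x in lebesgue_on ?I. (\<lambda>n. \<theta>s (r n) x) \<longlonglongrightarrow> \<theta> x"
    using r(2) by eventually_elim (simp add: LIM_zero_iff)
  have wells: "AE x in lebesgue_on ?I. \<theta> x \<in> {- \<beta>, \<beta>}"
    unfolding \<beta>_def
  proof (rule bounded_energy_limit_in_wells[where ?D1.0 = D1 and M = M and \<epsilon> = "\<epsilon> \<circ> r" and \<theta>s = "\<theta>s \<circ> r" and gs = "gs \<circ> r"])
    show "(\<epsilon> \<circ> r) \<longlonglongrightarrow> 0" by (rule LIMSEQ_subseq_LIMSEQ[OF \<epsilon>(2) r(1)])
  qed (use pos \<epsilon> \<theta>pi lim F in \<open>simp_all del: atLeastAtMost_iff\<close>)

  define rep where "rep = (\<lambda>j \<rho> v. continuous_on {-l..l} \<rho> \<and> (AE x in lebesgue_on ?I. \<theta>s j x = \<rho> x) \<and> \<rho> (-l) = \<rho> l \<and>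
    v absolutely_integrable_on {-l..l} \<and>
    (\<forall>x y. -l \<le> x \<longrightarrow> x \<le> y \<longrightarrow> y \<le> l \<longrightarrow> integral {x..y} v = \<rho> y - \<rho> x) \<and>
    integral {-l..l} (\<lambda>t. \<bar>2 * sqrt (W \<sigma> D2 (\<rho> t)) * v t\<bar>) \<le> M)"
  have "\<forall>j. \<exists>\<rho> v. rep j \<rho> v"
    unfolding rep_def by (intro allI Y_C_AC_representative[OF pos \<epsilon>(1) Y F M])
  then obtain \<rho> v where \<rho>v: "\<And>j. rep j (\<rho> j) (v j)" by metis
  have \<rho>: "continuous_on {-l..l} (\<rho> j)" "AE x in lebesgue_on ?I. \<theta>s j x = \<rho> j x" "\<rho> j (-l) = \<rho> j l"
    and v: "v j absolutely_integrable_on {-l..l}"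
    and inc: "\<And>x y. -l \<le> x \<Longrightarrow> x \<le> y \<Longrightarrow> y \<le> l \<Longrightarrow> integral {x..y} (v j) = \<rho> j y - \<rho> j x"
    for j using \<rho>v[of j] by (simp_all only: rep_def)
  define w where "w = (\<lambda>j x. \<Phi> (\<rho> j x))"
  define h where "h = (\<lambda>j t. 2 * sqrt (W \<sigma> D2 (\<rho> j t)) * v j t)"
  define u where "u = \<Phi> \<circ> \<theta>"
  have hM: "integral {-l..l} (\<lambda>t. \<bar>h j t\<bar>) \<le> M" for j using \<rho>v[of j] by (simp only: rep_def h_def)
  have h: "h j absolutely_integrable_on {-l..l}" for j
    unfolding h_def by (intro absolutely_integrable_continuous_mult v continuous_intros \<rho>)
  have ah: "(\<lambda>t. \<bar>h j t\<bar>) integrable_on {x..y}" if "-l \<le> x" "y \<le> l" for j x y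
  proof -
    have "(\<lambda>t. \<bar>h j t\<bar>) integrable_on {-l..l}" using h[of j] by (simp add: absolutely_integrable_on_def)
    then show ?thesis by (rule integrable_on_subinterval) (use that in auto)
  qed
  have cw: "continuous_on {-l..l} (w j)" for j
    unfolding w_def by (rule continuous_on_compose2[OF c\<Phi> \<rho>(1)]) auto
  have w_inc: "integral {x..y} (h j) = w j y - w j x" if xy: "-l \<le> x" "x \<le> y" "y \<le> l" for j x y
    unfolding h_def w_def
  proof (rule absolutely_continuous_chain[OF xy(2)])
    show "v j absolutely_integrable_on {x..y}"
      by (rule absolutely_integrable_on_subinterval[OF v]) (use xy in auto)
    show "continuous_on {x..y} (\<rho> j)"
      by (rule continuous_on_subset[OF \<rho>(1)]) (use xy in auto)
    show "integral {x'..y'} (v j) = \<rho> j y' - \<rho> j x'" if "x \<le> x'" "x' \<le> y'" "y' \<le> y" for x' y'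
      using that xy by (intro inc) auto
  qed (rule d\<Phi> c\<psi>)+

  have iu: "integrable (lebesgue_on ?I) u"
  proof (rule Bochner_Integration.integrable_bound)
    show "integrable (lebesgue_on ?I) (\<lambda>x. \<bar>\<Phi> 0\<bar> + K * \<bar>\<theta> x\<bar>)" using i\<theta> by auto
    have "\<bar>u x\<bar> \<le> \<bar>\<Phi> 0\<bar> + K * \<bar>\<theta> x\<bar>" for x using K(2)[of "\<theta> x" 0] by (simp add: u_def)
    then show "AE x in lebesgue_on ?I. norm (u x) \<le> norm (\<bar>\<Phi> 0\<bar> + K * \<bar>\<theta> x\<bar>)"
      using K(1) by simp
  qed (simp add: u_def)
  then have au: "u absolutely_integrable_on {-l..l}" by (simp add: integrable_lebesgue_on_Ioo_iff)
  have w_lim: "(\<lambda>j. integral {-l..l} (\<lambda>t. \<bar>w j t - u t\<bar>)) \<longlonglongrightarrow> 0"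
  proof (rule Lim_null_comparison)
    have "norm (integral {-l..l} (\<lambda>t. \<bar>w j t - u t\<bar>)) \<le> K * L1_dist ?I (\<theta>s j) \<theta>" for j
    proof -
      have "(\<lambda>t. w j t - u t) absolutely_integrable_on {-l..l}"
        by (rule set_integral_diff(1)[OF absolutely_integrable_continuous_real[OF cw] au])
      then have a: "(\<lambda>t. \<bar>w j t - u t\<bar>) absolutely_integrable_on {-l..l}"
        using absolutely_integrable_abs by fastforce
      have "integral {-l..l} (\<lambda>t. \<bar>w j t - u t\<bar>) = (\<integral>t. \<bar>w j t - u t\<bar> \<partial>lebesgue_on ?I)"
        by (rule integral_lebesgue_on_Ioo[OF a, symmetric])
      also have "\<dots> \<le> (\<integral>t. K * \<bar>\<theta>s j t - \<theta> t\<bar> \<partial>lebesgue_on ?I)"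
      proof (rule integral_mono_AE)
        show "AE t in lebesgue_on ?I. \<bar>w j t - u t\<bar> \<le> K * \<bar>\<theta>s j t - \<theta> t\<bar>"
          using \<rho>(2)[of j] by eventually_elim (simp add: w_def u_def K(2))
      qed (use a i\<theta> i\<theta>s[of j] in \<open>auto simp: integrable_lebesgue_on_Ioo_iff[symmetric]\<close>)
      finally show ?thesis
        using integral_nonneg[of "\<lambda>t. \<bar>w j t - u t\<bar>" "{-l..l}"] a
        by (simp add: L1_dist_def absolutely_integrable_on_def)
    qed
    then show "\<forall>\<^sub>F j in sequentially. norm (integral {-l..l} (\<lambda>t. \<bar>w j t - u t\<bar>)) \<le> K * L1_dist ?I (\<theta>s j) \<theta>"
      by simp
    show "(\<lambda>j. K * L1_dist ?I (\<theta>s j) \<theta>) \<longlonglongrightarrow> 0"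
      using tendsto_mult_left[OF \<theta>_lim, of K] by simp
  qed

  have "AE x in lebesgue_on ?I. (\<lambda>n. \<theta>s (r n) x) \<longlonglongrightarrow> \<theta> x \<and> \<theta> x \<in> {- \<beta>, \<beta>} \<and> (\<forall>j. \<theta>s j x = \<rho> j x)"
    using lim wells \<rho>(2) by (auto simp: AE_all_countable)
  then obtain N where N: "negligible N" "\<And>x. x \<in> ?I \<Longrightarrow> x \<notin> N \<Longrightarrow>
      (\<lambda>n. \<theta>s (r n) x) \<longlonglongrightarrow> \<theta> x \<and> \<theta> x \<in> {- \<beta>, \<beta>} \<and> (\<forall>j. \<theta>s j x = \<rho> j x)"
    by (rule AE_lebesgue_onE) auto
  \<comment> \<open>On this set of full measure all countably many almost-everywhere facts hold at
    once, so the counting argument can use actual points.\<close>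
  define E where "E = ?I - N"
  have E_lim: "(\<lambda>n. w (r n) x) \<longlonglongrightarrow> u x" if "x \<in> E" for x
  proof -
    have "isCont \<Phi> (\<theta> x)" using c\<Phi> by (simp add: continuous_on_eq_continuous_at)
    then have "(\<lambda>n. \<Phi> (\<theta>s (r n) x)) \<longlonglongrightarrow> \<Phi> (\<theta> x)"
      by (rule isCont_tendsto_compose) (use N(2)[of x] that in \<open>auto simp: E_def\<close>)
    then show ?thesis using N(2)[of x] that by (auto simp: E_def w_def u_def)
  qed
  have E_val: "\<theta> x \<in> {- \<beta>, \<beta>}" if "x \<in> E" for x using N(2)[of x] that by (auto simp: E_def)
  \<comment> \<open>The affine map sends 0 to \<open>- \<beta>\<close> and P to \<beta>; it inverts
    \<Phi> on the two wells.\<close>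
  have u_val: "u x \<in> {0, P}" and u_inj: "\<theta> x = 2 * \<beta> / P * u x - \<beta>" if "x \<in> E" for x
    using E_val[OF that] \<Phi>\<beta> by (auto simp: u_def)
  have AE_E: "AE x in lebesgue_on S. Q x" if "S \<subseteq> ?I" "S \<in> sets lebesgue" "\<And>x. x \<in> E \<Longrightarrow> x \<in> S \<Longrightarrow> Q x" for S Q
  proof -
    have "AE x in lebesgue. x \<notin> N" using N(1) by (auto simp: negligible_iff_null_sets intro: AE_not_in)
    then show ?thesis
      using that by (auto simp: AE_restrict_space_iff E_def elim!: eventually_mono)
  qed
  have E_dense: "\<exists>x\<in>E. p < x \<and> x < q" if "-l \<le> p" "p < q" "q \<le> l" for p q
  proof (rule ccontr)
    assume "\<not> ?thesis"
    then have "{p<..<q} \<subseteq> N" using that by (force simp: E_def)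
    then have "negligible {p<..<q}" using N(1) negligible_subset by blast
    then show False using open_not_negligible[of "{p<..<q}"] that by auto
  qed

  \<comment> \<open>The variation function of \<open>w j\<close>: its increments dominate those of
    \<open>w j\<close>, and its total is at most M.\<close>
  define m where "m = (\<lambda>j x. integral {-l..x} (\<lambda>t. \<bar>h j t\<bar>))"
  have m_diff: "m j y - m j x = integral {x..y} (\<lambda>t. \<bar>h j t\<bar>)" if "-l \<le> x" "x \<le> y" "y \<le> l" for j x y
    using Henstock_Kurzweil_Integration.integral_combine[of "-l" x y "\<lambda>t. \<bar>h j t\<bar>"] ah[of "-l" y j] that
    by (simp add: m_def)
  have var: "\<bar>w (r n) y - w (r n) x\<bar> \<le> m (r n) y - m (r n) x" if "x \<in> E" "y \<in> E" "x \<le> y" for n x y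
  proof -
    have xy: "-l \<le> x" "x \<le> y" "y \<le> l" using that by (auto simp: E_def)
    have "h (r n) absolutely_integrable_on {x..y}"
      by (rule absolutely_integrable_on_subinterval[OF h]) (use xy in auto)
    then have "norm (integral {x..y} (h (r n))) \<le> integral {x..y} (\<lambda>t. \<bar>h (r n) t\<bar>)"
      by (intro integral_norm_bound_integral) (auto simp: absolutely_integrable_on_def)
    then show ?thesis by (simp add: w_inc[OF xy] m_diff[OF xy])
  qed
  have m_le: "m (r n) y - m (r n) x \<le> M" if "x \<in> E" "y \<in> E" for n x y
  proof -
    have xy: "-l \<le> x" "x \<le> l" "-l \<le> y" "y \<le> l" using that by (auto simp: E_def)
    have "m (r n) y \<le> m (r n) l"
      using m_diff[of y l "r n"] xy integral_nonneg[OF ah[of y l "r n"]] by auto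
    moreover have "m (r n) x \<ge> 0"
      unfolding m_def by (rule integral_nonneg) (use ah[of "-l" x "r n"] xy in auto)
    ultimately show ?thesis using hM[of "r n"] by (simp add: m_def)
  qed
  have E_bounds: "E \<subseteq> {..<l}" "E \<subseteq> {-l<..}" by (auto simp: E_def)
  obtain k c where c: "c < l" "\<And>x. x \<in> E \<Longrightarrow> c < x \<Longrightarrow> u x = k"
    using two_valued_limit_eventually_constant_right[of E l "\<lambda>n. w (r n)" "\<lambda>n. m (r n)" M u 0 P, OF E_bounds(1) var m_le E_lim u_val]
    by blast
  obtain k' d where d: "- l < d" "\<And>x. x \<in> E \<Longrightarrow> x < d \<Longrightarrow> u x = k'"
    using two_valued_limit_eventually_constant_left[of E "-l" "\<lambda>n. w (r n)" "\<lambda>n. m (r n)" M u 0 P, OF E_bounds(2) var m_le E_lim u_val]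
    by blast
  \<comment> \<open>Clipping keeps both end intervals inside I, where the almost-everywhere
    statements apply.\<close>
  define c' d' where "c' = max c (-l)" and "d' = min d l"
  have cd': "c' < l" "- l < d'" "-l \<le> c'" "d' \<le> l" using c(1) d(1) ll by (simp_all add: c'_def d'_def)
  have u_c: "u x = k" "\<theta> x = 2 * \<beta> / P * k - \<beta>" if "x \<in> E" "c' < x" for x
    using c(2)[of x] u_inj[of x] that by (simp_all add: c'_def)
  have u_d: "u x = k'" "\<theta> x = 2 * \<beta> / P * k' - \<beta>" if "x \<in> E" "x < d'" for x
    using d(2)[of x] u_inj[of x] that by (simp_all add: d'_def)
  have right: "{c'<..<l} \<subseteq> ?I" "{c'<..<l} \<in> sets lebesgue" and left: "{-l<..<d'} \<subseteq> ?I" "{-l<..<d'} \<in> sets lebesgue"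
    using cd' by auto
  have u_right: "AE x in lebesgue_on {c'<..<l}. u x = k"
    and \<theta>_right: "AE x in lebesgue_on {c'<..<l}. \<theta> x = 2 * \<beta> / P * k - \<beta>"
    by (rule AE_E[OF right]; rule u_c; simp)+
  have u_left: "AE x in lebesgue_on {-l<..<d'}. u x = k'"
    and \<theta>_left: "AE x in lebesgue_on {-l<..<d'}. \<theta> x = 2 * \<beta> / P * k' - \<beta>"
    by (rule AE_E[OF left]; rule u_d; simp)+
  \<comment> \<open>This turns the trace of \<theta> into the end value of u. The identity is read
    off at one point of E close to l, which exists since E has full measure.\<close>
  have k: "\<Phi> (2 * \<beta> / P * k - \<beta>) = k"
  proof -
    obtain x where "x \<in> E" "c' < x" using E_dense[OF cd'(3,1)] by blast
    from u_c[OF this] show ?thesis unfolding u_def comp_def by simp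
  qed
  have k': "\<Phi> (2 * \<beta> / P * k' - \<beta>) = k'"
  proof -
    obtain x where "x \<in> E" "x < d'" using E_dense[OF _ cd'(2,4)] by blast
    from u_d[OF this] show ?thesis unfolding u_def comp_def by simp
  qed
  have TV: "total_variation ?I u + ennreal \<bar>k - k'\<bar> \<le> ennreal M"
  proof (rule total_variation_plus_boundary_jump_le[OF au _ cd'(1) u_right cd'(2) u_left ll])
    show "integral {-l..l} (\<lambda>t. u t * \<phi>' t) \<le> M"
      if "\<And>s. (\<phi> has_real_derivative \<phi>' s) (at s)" "continuous_on UNIV \<phi>'" "\<And>s. \<bar>\<phi> s\<bar> \<le> 1" "\<phi> (-l) = \<phi> l" for \<phi> \<phi>'
      by (rule integral_mult_deriv_le_if_L1_limit[OF _ h w_inc cw _ hM au w_lim that]) (use ll \<rho>(3) in \<open>auto simp: w_def\<close>)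
  qed

  have uBV: "u \<in> BV ?I"
    using TV iu by (auto simp: BV_def L1_on_def intro: le_less_trans[OF order_trans[OF _ TV]])
  have \<theta>BV: "\<theta> \<in> BV ?I"
    by (rule BV_Ioo_affine[OF uBV ll, of _ "2 * \<beta> / P" "- \<beta>"]) (use u_inj in \<open>auto intro!: AE_E\<close>)
  \<comment> \<open>Sine is odd, hence linear on the two points \<open>- \<beta>\<close> and
    \<beta>. Its slope is positive because \<beta> lies below pi/2, so a vanishing mean of the sine
    gives a vanishing mean of \<theta>.\<close>
  have sin_eq: "sin (\<theta> x) = sin \<beta> / \<beta> * \<theta> x" if "x \<in> E" for x using E_val[OF that] \<beta> by auto
  note deriv = bounded_energy_derivative_limit[OF pos \<epsilon> \<theta> g Y \<theta>_lim g_lim F M]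
  note deriv' = has_weak_deriv_weak_deriv[OF deriv(1)]
  have dg: "AE x in lebesgue_on ?I. weak_deriv ?I g x = - sin (\<theta> x)"
    by (rule has_weak_deriv_unique[OF deriv' deriv(1) ll])
  have sinL2: "(\<lambda>x. - sin (\<theta> x)) \<in> L2_on ?I"
    by (rule bounded_measurable_in_L2_on_Ioo[of _ _ _ 1]) auto
  have gW12: "g \<in> W12 ?I" using g deriv(1) sinL2 by (auto simp: W12_def)
  have "AE x in lebesgue_on ?I. weak_deriv ?I g x = - (sin \<beta> / \<beta>) * \<theta> x + 0"
  proof -
    have "AE x in lebesgue_on ?I. sin (\<theta> x) = sin \<beta> / \<beta> * \<theta> x" by (rule AE_E) (simp_all add: sin_eq)
    with dg show ?thesis by eventually_elim simp
  qed
  then have dgBV: "weak_deriv ?I g \<in> BV ?I" by (rule BV_Ioo_affine[OF \<theta>BV ll])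
  have "(\<integral>x. sin (\<theta> x) \<partial>lebesgue_on ?I) = (\<integral>x. sin \<beta> / \<beta> * \<theta> x \<partial>lebesgue_on ?I)"
    by (rule integral_cong_AE) (auto intro!: AE_E simp: sin_eq)
  then have "sin \<beta> / \<beta> * (\<integral>x. \<theta> x \<partial>lebesgue_on ?I) = 0" using deriv(2) by simp
  moreover have "sin \<beta> > 0" using \<beta> by (intro sin_gt_zero) auto
  ultimately have mean: "(\<integral>x. \<theta> x \<partial>lebesgue_on ?I) = 0" using \<beta> by simp
  show A: "(\<theta>, g) \<in> A_C l"
    using \<theta>BV gW12 dgBV dg mean by (auto simp: A_C_def elim: eventually_mono)
  have "trace_left \<theta> l = 2 * \<beta> / P * k - \<beta>" by (rule trace_left_eqI[OF cd'(1) \<theta>_right])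
  moreover have "trace_right \<theta> (-l) = 2 * \<beta> / P * k' - \<beta>" by (rule trace_right_eqI[OF cd'(2) \<theta>_left])
  ultimately show "G0_C \<sigma> D2 l \<theta> g \<le> ennreal M"
    using A TV k k' by (simp add: G0_C_def u_def \<Phi>_def)
qed

text \<open>Shifting \<theta> by 2 pi leaves the energy unchanged but not the mean required in
  \<open>A_C\<close>; the range in \<open>{-pi..pi}\<close> fixes the branch. Membership is
  concluded when the liminf is finite, as an infinite liminf gives no control on the limit and makes
  the inequality trivial.\<close>

theorem lemma3p1:
  fixes \<sigma> D1 D2 l :: real
    and \<epsilon> :: "nat \<Rightarrow> real"
    and \<theta> g :: "real \<Rightarrow> real"
    and \<theta>s gs :: "nat \<Rightarrow> real \<Rightarrow> real"
  assumes "\<sigma> > 0" and "D1 > 0" and "D2 > 0" and "l > 0"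
    and "\<And>j. \<epsilon> j > 0" and "\<epsilon> \<longlonglongrightarrow> 0"
    and "\<theta> \<in> L1_on {-l<..<l}" and "g \<in> L2_on {-l<..<l}"
    and "AE x in lebesgue_on {-l<..<l}. \<theta> x \<in> {-pi..pi}"
    and "\<And>j. (\<theta>s j, gs j) \<in> Y_C l"
    and "(\<lambda>j. L1_dist {-l<..<l} (\<theta>s j) \<theta>) \<longlonglongrightarrow> 0"
    and "(\<lambda>j. L2_dist {-l<..<l} (gs j) g) \<longlonglongrightarrow> 0"
  shows "liminf (\<lambda>j. G_C \<sigma> D1 D2 l (\<epsilon> j) (\<theta>s j) (gs j)) \<ge> G0_C \<sigma> D2 l \<theta> g
    \<and> (liminf (\<lambda>j. G_C \<sigma> D1 D2 l (\<epsilon> j) (\<theta>s j) (gs j)) < \<infinity> \<longrightarrow> (\<theta>, g) \<in> A_C l)"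
proof -
  define G where "G = (\<lambda>j. G_C \<sigma> D1 D2 l (\<epsilon> j) (\<theta>s j) (gs j))"
  \<comment> \<open>A number strictly above the liminf bounds the energies along a subsequence;
    letting z decrease to the liminf then gives the sharp inequality.\<close>
  have bound: "(\<theta>, g) \<in> A_C l \<and> G0_C \<sigma> D2 l \<theta> g \<le> z" if z: "liminf G < z" "z < \<infinity>" for z
  proof -
    obtain M where M: "z = ennreal M" "M \<ge> 0" using z(2) by (cases z) auto
    obtain r where r: "strict_mono r" "(G \<circ> r) \<longlonglongrightarrow> liminf G" using liminf_subseq_lim by blast
    have "\<forall>\<^sub>F n in sequentially. (G \<circ> r) n < z" using r(2) z(1) by (rule order_tendstoD)
    then obtain n0 where n0: "\<And>n. n \<ge> n0 \<Longrightarrow> (G \<circ> r) n < z" by (auto simp: eventually_sequentially)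
    \<comment> \<open>The shift by \<open>n0\<close> discards the initial terms, so that the bound
      holds for every index.\<close>
    define s where "s = (\<lambda>n. r (n + n0))"
    have s: "strict_mono s" using r(1) by (auto simp: s_def strict_mono_def)
    have "F_C \<sigma> D1 D2 l (\<epsilon> (s n)) (\<theta>s (s n)) (gs (s n)) \<le> ennreal M" for n
      using n0[of "n + n0"] assms(10)[of "s n"] by (simp add: G_def G_C_def s_def M less_imp_le)
    note lower = bounded_energy_lower_bound[where \<epsilon> = "\<lambda>n. \<epsilon> (s n)" and \<theta>s = "\<lambda>n. \<theta>s (s n)" and gs = "\<lambda>n. gs (s n)",
        OF assms(1-5) _ assms(7-10) _ _ this M(2)]
    note sub = LIMSEQ_subseq_LIMSEQ[OF _ s, unfolded comp_def]
    show ?thesis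
      using lower[OF sub[OF assms(6)] sub[OF assms(11)] sub[OF assms(12)]] M(1) by simp
  qed
  have "G0_C \<sigma> D2 l \<theta> g \<le> liminf G"
  proof (rule dense_ge)
    fix z assume "liminf G < z"
    then show "G0_C \<sigma> D2 l \<theta> g \<le> z" using bound[of z] by (cases "z = \<infinity>") (auto simp: less_top)
  qed
  moreover have "(\<theta>, g) \<in> A_C l" if "liminf G < \<infinity>"
    using dense[OF that] bound by blast
  ultimately show ?thesis by (simp add: G_def)
qed

end
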